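(* Let $\mathbf{X}=(X_1,\ldots,X_N)^\intercal$ be a vector of $N\in\mathbb{N}$ input random variables fulfilling the assumptions listed in the context. Let a degree $\mathbf{p}=(p_1,\ldots,p_N)\in\mathbb{N}_0^N$ and a family of knot sequences $\boldsymbol{\Xi}=\{\boldsymbol{\xi}_1,\ldots,\boldsymbol{\xi}_N\}$ be given, and let $\{\Psi_{\mathbf{i},\mathbf{p},\boldsymbol{\Xi}}(\mathbf{X}):\mathbf{i}\in\mathcal{I}_{\mathbf{n}}\}$ be the set of multivariate orthonormal B-splines consistent with the probability measure $f_{\mathbf{X}}(\mathbf{x})d\mathbf{x}$. Then, for any random variable $y(\mathbf{X})\in L^2(\Omega,\mathcal{F},\mathbb{P})$, there exists an orthogonal expansion in multivariate orthonormal splines in $\mathbf{X}$ (the SCE approximation of $y(\mathbf{X})$) $$y_{\mathbf{p},\boldsymbol{\Xi}}(\mathbf{X}):=\sum_{\mathbf{i}\in\mathcal{I}_{\mathbf{n}}}C_{\mathbf{i},\mathbf{p},\boldsymbol{\Xi}}\Psi_{\mathbf{i},\mathbf{p},\boldsymbol{\Xi}}(\mathbf{X}),$$ where the expansion coefficients $C_{\mathbf{i},\mathbf{p},\boldsymbol{\Xi}}\in\mathbb{R}$ are defined as $$C_{\mathbf{i},\mathbf{p},\boldsymbol{\Xi}}:=\mathbb{E}[y(\mathbf{X})\Psi_{\mathbf{i},\mathbf{p},\boldsymbol{\Xi}}(\mathbf{X})]=\int_{\mathbb{A}^N}y(\mathbf{x})\Psi_{\mathbf{i},\mathbf{p},\boldsymbol{\Xi}}(\mathbf{x})f_{\mathbf{X}}(\mathbf{x})\,d\mathbf{x},\quad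 \mathbf{i}\in\mathcal{I}_{\mathbf{n}}.$$ Furthermore, the SCE approximation is the best approximation of $y(\mathbf{X})$ in the sense that $$\mathbb{E}\left[\{y(\mathbf{X})-y_{\mathbf{p},\boldsymbol{\Xi}}(\mathbf{X})\}^2\right]=\inf_{g\in\mathcal{S}_{\mathbf{p},\boldsymbol{\Xi}}}\mathbb{E}\left[\{y(\mathbf{X})-g(\mathbf{X})\}^2\right],$$ or, equivalently, $$\|y(\mathbf{x})-y_{\mathbf{p},\boldsymbol{\Xi}}(\mathbf{x})\|_{L^2(\mathbb{A}^N,\mathcal{B}^N,f_{\mathbf{X}}d\mathbf{x})}=\inf_{g\in\mathcal{S}_{\mathbf{p},\boldsymbol{\Xi}}}\|y(\mathbf{x})-g(\mathbf{x})\|_{L^2(\mathbb{A}^N,\mathcal{B}^N,f_{\mathbf{X}}d\mathbf{x})}.$$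
   Context: Inputs. $\mathbb{N}=\{1,2,\ldots\}$, $\mathbb{N}_0=\mathbb{N}\cup\{0\}$. $(\Omega,\mathcal{F},\mathbb{P})$ is a probability space, $\mathbb{A}^N=\times_{k=1}^N[a_k,b_k]$ with finite reals $a_k<b_k$, $\mathcal{B}^N$ is the Borel $\sigma$-algebra on $\mathbb{A}^N$, and $\mathbf{X}=(X_1,\ldots,X_N)^\intercal:(\Omega,\mathcal{F})\to(\mathbb{A}^N,\mathcal{B}^N)$ is a random vector such that: (1) the $X_k$ are statistically independent (not necessarily identically distributed); (2) each $X_k$ takes values in $[a_k,b_k]$ (so all its moments are finite); (3) each $X_k$ has an absolutely continuous distribution function and a density $f_{X_k}$, continuous on $[a_k,b_k]$, with support $[a_k,b_k]$ (the closure of $\{f_{X_k}>0\}$). The joint density is $f_{\mathbf{X}}(\mathbf{x})=\prod_{k=1}^Nf_{X_k}(x_k)$, with support $\mathbb{A}^N$. Univariate B-splines. For each $k$, let $n_k>p_k\ge0$ be integers and let $\boldsymbol{\xi}_k=\{\xi_{k,1}\le\cdots\le\xi_{k,n_k+p_k+1}\}$ be a $(p_k+1)$-open knot sequence on $[a_k,b_k]$: its distinct values are $a_k=\zeta_{k,1}<\cdots<\zeta_{k,r_k}=b_k$, with multiplicities $m_{k,1}=m_{k,r_k}=p_k+1$ and $1\le m_{k,j}\le p_k+1$ for $2\le j\le r_k-1$. B-splines: $B^k_{i,0,\boldsymbol{\xi}_k}(x)=1$ if $\xi_{k,i}\le x<\xi_{k,i+1}$ and $0$ otherwise; for $q\ge1$,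 $B^k_{i,q,\boldsymbol{\xi}_k}(x)=\frac{x-\xi_{k,i}}{\xi_{k,i+q}-\xi_{k,i}}B^k_{i,q-1,\boldsymbol{\xi}_k}(x)+\frac{\xi_{k,i+q+1}-x}{\xi_{k,i+q+1}-\xi_{k,i+1}}B^k_{i+1,q-1,\boldsymbol{\xi}_k}(x)$, terms with zero denominator being zero; values at $x=b_k$ are taken as left limits. The degree-$p_k$ B-splines are $B^k_{i,p_k,\boldsymbol{\xi}_k}$, $1\le i\le n_k$. The spline space $\mathcal{S}_{k,p_k,\boldsymbol{\xi}_k}$ is the set of $g:[a_k,b_k]\to\mathbb{R}$ for which there are real polynomials $g_1,\ldots,g_{r_k-1}$ of degree at most $p_k$ with $g=g_j$ on $[\zeta_{k,j},\zeta_{k,j+1})$ (the last interval closed at $b_k$) and $g_{j-1}^{(l)}(\zeta_{k,j})=g_j^{(l)}(\zeta_{k,j})$ for $0\le l\le p_k-m_{k,j}$, $2\le j\le r_k-1$. It is known that $\mathcal{S}_{k,p_k,\boldsymbol{\xi}_k}=\operatorname{span}\{B^k_{i,p_k,\boldsymbol{\xi}_k}\}_{i=1}^{n_k}$ has dimension $n_k$. Orthonormal B-splines. $\mathbf{P}_k(x_k)=(1,B^k_{2,p_k,\boldsymbol{\xi}_k}(x_k),\ldots,B^k_{n_k,p_k,\boldsymbol{\xi}_k}(x_k))^\intercal$, $\mathbf{G}_k=\mathbb{E}[\mathbf{P}_k(X_k)\mathbf{P}_k^\intercal(X_k)]$ (symmetric positive-definite), $\mathbf{G}_k=\mathbf{Q}_k\mathbf{Q}_k^\intercal$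 is the Cholesky factorization ($\mathbf{Q}_k$ lower triangular with positive diagonal), and $\boldsymbol{\psi}_k(x_k)=(\psi^k_{1,p_k,\boldsymbol{\xi}_k}(x_k),\ldots,\psi^k_{n_k,p_k,\boldsymbol{\xi}_k}(x_k))^\intercal=\mathbf{Q}_k^{-1}\mathbf{P}_k(x_k)$. With $\mathbf{n}=(n_1,\ldots,n_N)$, $\mathcal{I}_{\mathbf{n}}=\{(i_1,\ldots,i_N):1\le i_k\le n_k,\ k=1,\ldots,N\}$, the multivariate orthonormal B-splines are $\Psi_{\mathbf{i},\mathbf{p},\boldsymbol{\Xi}}(\mathbf{x})=\prod_{k=1}^N\psi^k_{i_k,p_k,\boldsymbol{\xi}_k}(x_k)$, $\mathbf{i}\in\mathcal{I}_{\mathbf{n}}$. The tensor-product spline space is $\mathcal{S}_{\mathbf{p},\boldsymbol{\Xi}}=\bigotimes_{k=1}^N\mathcal{S}_{k,p_k,\boldsymbol{\xi}_k}$, i.e. the span of the functions $\mathbf{x}\mapsto\prod_kg_k(x_k)$ with $g_k\in\mathcal{S}_{k,p_k,\boldsymbol{\xi}_k}$. Function spaces. $L^2(\mathbb{A}^N,\mathcal{B}^N,f_{\mathbf{X}}d\mathbf{x})$ is the weighted space of (classes of) measurable $y:\mathbb{A}^N\to\mathbb{R}$ with $\int_{\mathbb{A}^N}|y|^2f_{\mathbf{X}}d\mathbf{x}<\infty$, with its usual inner product and norm; $L^2(\Omega,\mathcal{F},\mathbb{P})$ here denotes the isomorphic space of (classes of) random variables $y(\mathbf{X})$ with $\mathbb{E}|y(\mathbf{X})|^2<\infty$.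 *)

theory Defs
  imports
    "HOL-Probability.Probability"
    "HOL-Library.Function_Algebras"
    "HOL-Computational_Algebra.Polynomial"
    "Jordan_Normal_Form.Gauss_Jordan_Elimination"
begin

no_notation vec_index (infixl \<open>$\<close> 100)

text \<open>
  All knot, spline and component indices are 1-based. The dimension \<open>N\<close> is the cardinality of
  the finite index type \<open>'n\<close>.
\<close>

definition knot_mult :: "nat \<Rightarrow> nat \<Rightarrow> (nat \<Rightarrow> real) \<Rightarrow> real \<Rightarrow> nat" where
  "knot_mult n p \<xi> z = card {i \<in> {1..n + p + 1}. \<xi> i = z}"

definition open_knot_seq :: "real \<Rightarrow> real \<Rightarrow> nat \<Rightarrow> nat \<Rightarrow> (nat \<Rightarrow> real) \<Rightarrow> bool" where
  "open_knot_seq a b n p \<xi> \<longleftrightarrow>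
     p < n \<and>
     mono_on {1..n + p + 1} \<xi> \<and>
     \<xi> 1 = a \<and> \<xi> (n + p + 1) = b \<and>
     knot_mult n p \<xi> a = p + 1 \<and> knot_mult n p \<xi> b = p + 1 \<and>
     (\<forall>z \<in> {a<..<b}. knot_mult n p \<xi> z \<le> p + 1)"

definition num_knots :: "nat \<Rightarrow> nat \<Rightarrow> (nat \<Rightarrow> real) \<Rightarrow> nat" where
  "num_knots n p \<xi> = card (\<xi> ` {1..n + p + 1})"

definition knot_val :: "nat \<Rightarrow> nat \<Rightarrow> (nat \<Rightarrow> real) \<Rightarrow> nat \<Rightarrow> real" where
  "knot_val n p \<xi> j = sorted_list_of_set (\<xi> ` {1..n + p + 1}) ! (j - 1)"

text \<open>In the recursion, terms with zero denominator vanish because \<open>x / 0 = 0\<close>.\<close>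

fun bspline_rec :: "(nat \<Rightarrow> real) \<Rightarrow> nat \<Rightarrow> nat \<Rightarrow> real \<Rightarrow> real" where
  "bspline_rec \<xi> 0 i x = (if \<xi> i \<le> x \<and> x < \<xi> (i + 1) then 1 else 0)"
| "bspline_rec \<xi> (Suc q) i x =
     (x - \<xi> i) / (\<xi> (i + Suc q) - \<xi> i) * bspline_rec \<xi> q i x +
     (\<xi> (i + Suc q + 1) - x) / (\<xi> (i + Suc q + 1) - \<xi> (i + 1)) * bspline_rec \<xi> q (i + 1) x"

definition bspline :: "real \<Rightarrow> nat \<Rightarrow> (nat \<Rightarrow> real) \<Rightarrow> nat \<Rightarrow> real \<Rightarrow> real" where
  "bspline b p \<xi> i x =
     (if x = b then Lim (at_left b) (bspline_rec \<xi> p i) else bspline_rec \<xi> p i x)"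

text \<open>
  Functions on \<open>[a, b]\<close> are represented by their extensions by zero to the real line. The
  smoothness condition \<open>l \<le> p - m\<close> is written additively since subtraction of naturals truncates.
\<close>

definition spline_space :: "real \<Rightarrow> real \<Rightarrow> nat \<Rightarrow> nat \<Rightarrow> (nat \<Rightarrow> real) \<Rightarrow> (real \<Rightarrow> real) set" where
  "spline_space a b n p \<xi> =
     {g. (\<forall>x. x \<notin> {a..b} \<longrightarrow> g x = 0) \<and>
         (\<exists>P :: nat \<Rightarrow> real poly.
            (\<forall>j \<in> {1..num_knots n p \<xi> - 1}. degree (P j) \<le> p \<and>
               (\<forall>x \<in> {knot_val n p \<xi> j..<knot_val n p \<xi> (j + 1)}. g x = poly (P j) x)) \<and>
            g b = poly (P (num_knots n p \<xi> - 1)) b \<and>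
            (\<forall>j \<in> {2..num_knots n p \<xi> - 1}. \<forall>l.
               l + knot_mult n p \<xi> (knot_val n p \<xi> j) \<le> p \<longrightarrow>
               poly ((pderiv ^^ l) (P (j - 1))) (knot_val n p \<xi> j) =
               poly ((pderiv ^^ l) (P j)) (knot_val n p \<xi> j)))}"

definition aux_bspline :: "real \<Rightarrow> nat \<Rightarrow> (nat \<Rightarrow> real) \<Rightarrow> nat \<Rightarrow> real \<Rightarrow> real" where
  "aux_bspline b p \<xi> i x = (if i = 1 then 1 else bspline b p \<xi> i x)"

definition gram_mat ::
  "'w measure \<Rightarrow> ('w \<Rightarrow> real) \<Rightarrow> real \<Rightarrow> nat \<Rightarrow> nat \<Rightarrow> (nat \<Rightarrow> real) \<Rightarrow> real mat" where
  "gram_mat M Z b n p \<xi> =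
     mat n n (\<lambda>(i, j). LINT \<omega>|M. aux_bspline b p \<xi> (i + 1) (Z \<omega>) * aux_bspline b p \<xi> (j + 1) (Z \<omega>))"

text \<open>The factor is unique for positive-definite matrices, so the choice below is immaterial.\<close>

definition cholesky :: "real mat \<Rightarrow> real mat" where
  "cholesky G = (SOME Q. Q \<in> carrier_mat (dim_row G) (dim_row G) \<and>
     upper_triangular (transpose_mat Q) \<and>
     (\<forall>i < dim_row G. 0 < Q $$ (i, i)) \<and>
     G = Q * transpose_mat Q)"

definition orth_bspline ::
  "'w measure \<Rightarrow> ('w \<Rightarrow> real) \<Rightarrow> real \<Rightarrow> nat \<Rightarrow> nat \<Rightarrow> (nat \<Rightarrow> real) \<Rightarrow> nat \<Rightarrow> real \<Rightarrow> real" where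
  "orth_bspline M Z b n p \<xi> i x =
     vec_index (the (mat_inverse (cholesky (gram_mat M Z b n p \<xi>))) *\<^sub>v
       Matrix.vec n (\<lambda>j. aux_bspline b p \<xi> (j + 1) x)) (i - 1)"

definition multi_indices :: "('n \<Rightarrow> nat) \<Rightarrow> ('n \<Rightarrow> nat) set" where
  "multi_indices n = {i. \<forall>k. i k \<in> {1..n k}}"

definition orth_mbspline ::
  "'w measure \<Rightarrow> ('w \<Rightarrow> real ^ 'n) \<Rightarrow> real ^ 'n \<Rightarrow> ('n \<Rightarrow> nat) \<Rightarrow> ('n \<Rightarrow> nat) \<Rightarrow> ('n \<Rightarrow> nat \<Rightarrow> real)
     \<Rightarrow> ('n::finite \<Rightarrow> nat) \<Rightarrow> real ^ 'n \<Rightarrow> real" where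
  "orth_mbspline M X b n p \<xi> i x =
     (\<Prod>k\<in>UNIV. orth_bspline M (\<lambda>\<omega>. X \<omega> $ k) (b $ k) (n k) (p k) (\<xi> k) (i k) (x $ k))"

definition tensor_spline_space ::
  "real ^ 'n \<Rightarrow> real ^ 'n \<Rightarrow> ('n \<Rightarrow> nat) \<Rightarrow> ('n \<Rightarrow> nat) \<Rightarrow> ('n::finite \<Rightarrow> nat \<Rightarrow> real)
     \<Rightarrow> (real ^ 'n \<Rightarrow> real) set" where
  "tensor_spline_space a b n p \<xi> =
     module.span (\<lambda>(c::real) h x. c * h x)
       {(\<lambda>x. \<Prod>k\<in>UNIV. g k (x $ k)) | g. \<forall>k. g k \<in> spline_space (a $ k) (b $ k) (n k) (p k) (\<xi> k)}"

definition sce_coeff ::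
  "'w measure \<Rightarrow> ('w \<Rightarrow> real ^ 'n) \<Rightarrow> real ^ 'n \<Rightarrow> ('n \<Rightarrow> nat) \<Rightarrow> ('n \<Rightarrow> nat) \<Rightarrow> ('n \<Rightarrow> nat \<Rightarrow> real)
     \<Rightarrow> (real ^ 'n \<Rightarrow> real) \<Rightarrow> ('n::finite \<Rightarrow> nat) \<Rightarrow> real" where
  "sce_coeff M X b n p \<xi> y i = (LINT \<omega>|M. y (X \<omega>) * orth_mbspline M X b n p \<xi> i (X \<omega>))"

definition sce ::
  "'w measure \<Rightarrow> ('w \<Rightarrow> real ^ 'n) \<Rightarrow> real ^ 'n \<Rightarrow> ('n \<Rightarrow> nat) \<Rightarrow> ('n \<Rightarrow> nat) \<Rightarrow> ('n \<Rightarrow> nat \<Rightarrow> real)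
     \<Rightarrow> (real ^ 'n \<Rightarrow> real) \<Rightarrow> real ^ ('n::finite) \<Rightarrow> real" where
  "sce M X b n p \<xi> y x =
     (\<Sum>i\<in>multi_indices n. sce_coeff M X b n p \<xi> y i * orth_mbspline M X b n p \<xi> i x)"

definition joint_density :: "('n::finite \<Rightarrow> real \<Rightarrow> real) \<Rightarrow> real ^ 'n \<Rightarrow> real" where
  "joint_density f x = (\<Prod>k\<in>UNIV. f k (x $ k))"

definition weighted_measure ::
  "real ^ 'n \<Rightarrow> real ^ 'n \<Rightarrow> ('n::finite \<Rightarrow> real \<Rightarrow> real) \<Rightarrow> (real ^ 'n) measure" where
  "weighted_measure a b f =
     density (restrict_space lborel (cbox a b)) (\<lambda>x. ennreal (joint_density f x))"

definition square_integrable :: "'x measure \<Rightarrow> ('x \<Rightarrow> real) \<Rightarrow> bool" where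
  "square_integrable \<mu> h \<longleftrightarrow> h \<in> borel_measurable \<mu> \<and> integrable \<mu> (\<lambda>x. (h x)\<^sup>2)"

definition L2_norm :: "'x measure \<Rightarrow> ('x \<Rightarrow> real) \<Rightarrow> real" where
  "L2_norm \<mu> h = sqrt (LINT x|\<mu>. (h x)\<^sup>2)"

end

theory Submission
  imports Defs "Jordan_Normal_Form.Determinant"
begin

text \<open>
  The spline chaos expansion is the orthogonal projection of \<open>y(X)\<close> onto the tensor-product spline
  space. Once it is known that the functions \<open>\<Psi>\<^sub>i\<close> are orthonormal in \<open>L\<^sup>2\<close> and span that space on the
  box, expanding the square gives
  \<open>E (y - \<Sum> d\<^sub>i \<Psi>\<^sub>i)\<^sup>2 = E y\<^sup>2 - \<Sum> C\<^sub>i\<^sup>2 + \<Sum> (d\<^sub>i - C\<^sub>i)\<^sup>2\<close> (lemma \<open>orthonormal_expansion_error\<close>),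
  whose minimum over \<open>d\<close> is attained exactly at the coefficients \<open>C\<^sub>i\<close>. So the work lies in the two
  hypotheses.

  Independence of the coordinates factorises the second moments of products, which reduces
  orthonormality to one coordinate; distributing products over sums does the same for spanning. There \<open>\<psi> = Q\<inverse> P\<close> with \<open>G = Q Q\<^sup>T\<close>, hence
  \<open>E \<psi> \<psi>\<^sup>T = Q\<inverse> G Q\<^sup>-\<^sup>T = 1\<close>; this needs a Cholesky factor, that is, positive definiteness of the Gram
  matrix \<open>G\<close>. Positive definiteness says that a combination of \<open>1, B\<^sub>2, \<dots>, B\<^sub>n\<close> which vanishes almost
  surely is trivial. Since the density is continuous and positive on a dense subset of \<open>[a, b]\<close>, such a
  combination has infinitely many zeros in every subinterval, and it is a piecewise polynomial.

  What remains is the Curry--Schoenberg theorem: \<open>1, B\<^sub>2, \<dots>, B\<^sub>n\<close> form a basis of the spline space. The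
  proof follows de Boor. Marsden's identity, read as an identity of polynomials in its second variable,
  puts every truncated power \<open>(x - z)\<^sub>+\<^sup>l\<close> of the spline space into the span of the B-splines
  (\<open>trunc_pow_eq_bspline_sum\<close>). There are exactly \<open>n\<close> such powers, they are independent
  (\<open>trunc_pow_independent\<close>), and by Taylor expansion of the jumps at the breakpoints they span the
  spline space (\<open>spline_space_in_span_trunc\<close>). Counting dimensions then yields independence of the
  B-splines and equality of the spans, without any computation of the smoothness of B-splines.
  Finally, the passage between \<open>\<Omega>\<close> and the weighted measure on the box holds because the latter is the
  law of \<open>X\<close> (\<open>weighted_measure_eq_distr\<close>).
\<close>

(* The symbol $ is reserved for the components of vectors in real ^ 'n. *)
no_notation vec_index (infixl \<open>$\<close> 100)

section \<open>Finite families of real functions\<close>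

interpretation fun_vs: vector_space "\<lambda>(c::real) (h::'x \<Rightarrow> real) x. c * h x"
  by unfold_locales (auto simp: fun_eq_iff algebra_simps)

lemma sum_fun_apply: "(\<Sum>i\<in>I. h i) x = (\<Sum>i\<in>I. h i (x::'a)::real)"
  by (induction I rule: infinite_finite_induct) auto

text \<open>
  Families are used instead of sets because B-splines are indexed: the coefficient form is what all
  later computations need, and it makes sense for families with repetitions.
\<close>

lemma span_family_iff:
  fixes v :: "'i \<Rightarrow> 'x \<Rightarrow> real"
  assumes "finite I"
  shows "h \<in> fun_vs.span (v ` I) \<longleftrightarrow> (\<exists>c. \<forall>x. h x = (\<Sum>i\<in>I. c i * v i x))"
proof
  assume "h \<in> fun_vs.span (v ` I)"
  then show "\<exists>c. \<forall>x. h x = (\<Sum>i\<in>I. c i * v i x)"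
  proof (induction rule: fun_vs.span_induct_alt)
    case base
    show ?case by (rule exI[of _ "\<lambda>_. 0"]) simp
  next
    case (step c u w)
    then obtain i d where i: "i \<in> I" "u = v i" and d: "\<And>x. w x = (\<Sum>i\<in>I. d i * v i x)"
      by auto
    have "(\<Sum>j\<in>I. (if j = i then c else 0) * v j x) = c * u x" for x
      using assms i by (simp add: if_distrib[of "\<lambda>t. t * _"] cong: if_cong)
    then show ?case
      by (intro exI[of _ "\<lambda>j. (if j = i then c else 0) + d j"])
        (simp add: d distrib_right sum.distrib)
  qed
next
  assume "\<exists>c. \<forall>x. h x = (\<Sum>i\<in>I. c i * v i x)"
  then obtain c where "\<And>x. h x = (\<Sum>i\<in>I. c i * v i x)" by blast
  then have "h = (\<Sum>i\<in>I. (\<lambda>x. c i * v i x))"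
    by (simp add: fun_eq_iff sum_fun_apply)
  also have "\<dots> \<in> fun_vs.span (v ` I)"
    by (intro fun_vs.span_sum fun_vs.span_scale fun_vs.span_base) auto
  finally show "h \<in> fun_vs.span (v ` I)" .
qed

lemma independent_family:
  fixes t :: "'j \<Rightarrow> 'x \<Rightarrow> real"
  assumes J: "finite J"
    and t: "\<And>c. \<forall>x. (\<Sum>j\<in>J. c j * t j x) = 0 \<Longrightarrow> \<forall>j\<in>J. c j = 0"
  shows "inj_on t J" "fun_vs.independent (t ` J)"
proof -
  show inj: "inj_on t J"
  proof (rule inj_onI, rule ccontr)
    fix i j assume ij: "i \<in> J" "j \<in> J" "t i = t j" "i \<noteq> j"
    let ?c = "\<lambda>k. (if k = i then 1 else 0) - (if k = j then 1 else 0 :: real)"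
    have "(\<Sum>k\<in>J. ?c k * t k x) = t i x - t j x" for x
      using J ij by (simp add: left_diff_distrib sum_subtractf if_distrib[of "\<lambda>t. t * _"] cong: if_cong)
    then have "\<forall>k\<in>J. ?c k = 0" using t[of ?c] ij by simp
    with ij show False by auto
  qed
  show "fun_vs.independent (t ` J)"
  proof (rule fun_vs.independent_if_scalars_zero)
    show "finite (t ` J)" using J by simp
    fix f u assume s: "(\<Sum>x\<in>t ` J. (\<lambda>y. f x * x y)) = 0" and u: "u \<in> t ` J"
    from s have "(\<Sum>j\<in>J. (\<lambda>y. f (t j) * t j y)) = 0" by (simp add: sum.reindex[OF inj])
    then have "\<forall>x. (\<Sum>j\<in>J. f (t j) * t j x) = 0"
      by (metis (mono_tags, lifting) sum_fun_apply sum.cong zero_fun_apply)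
    from t[OF this] u show "f u = 0" by auto
  qed
qed

text \<open>
  The exchange argument for indexed families: \<open>card J\<close> independent functions inside the span of at most
  as many functions \<open>v\<^sub>i\<close> leave no room for a relation among the \<open>v\<^sub>i\<close> (else fewer of them would span) nor
  for a \<open>v\<^sub>i\<close> outside the span of \<open>t\<close> (else it would be one more independent function).
\<close>

lemma steinitz_families:
  fixes t :: "'j \<Rightarrow> 'x \<Rightarrow> real" and v :: "'i \<Rightarrow> 'x \<Rightarrow> real"
  assumes I: "finite I" and J: "finite J" and card: "card I \<le> card J"
    and t: "\<And>c. \<forall>x. (\<Sum>j\<in>J. c j * t j x) = 0 \<Longrightarrow> \<forall>j\<in>J. c j = 0"
    and span: "\<And>j. j \<in> J \<Longrightarrow> t j \<in> fun_vs.span (v ` I)"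
  shows "\<forall>x. (\<Sum>i\<in>I. c i * v i x) = 0 \<Longrightarrow> \<forall>i\<in>I. c i = 0"
    and "i \<in> I \<Longrightarrow> v i \<in> fun_vs.span (t ` J)"
proof -
  have ind: "inj_on t J" "fun_vs.independent (t ` J)"
    by (rule independent_family[OF J], fact t)+
  have card_t: "card (t ` J) = card J" using ind(1) by (rule card_image)
  {
    assume z: "\<forall>x. (\<Sum>i\<in>I. c i * v i x) = 0"
    show "\<forall>i\<in>I. c i = 0"
    proof (rule ccontr)
      assume "\<not> (\<forall>i\<in>I. c i = 0)"
      then obtain k where k: "k \<in> I" "c k \<noteq> 0" by blast
      have vk_eq: "v k x = (\<Sum>i\<in>I - {k}. (- c i / c k) * v i x)" for x
      proof -
        have "c k * v k x = - (\<Sum>i\<in>I - {k}. c i * v i x)"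
          using z[rule_format, of x] I k by (simp add: sum.remove)
        then have "v k x = (1 / c k) * - (\<Sum>i\<in>I - {k}. c i * v i x)"
          using k by (simp add: field_simps)
        then show ?thesis
          by (simp add: sum_distrib_left sum_negf[symmetric] sum_divide_distrib)
      qed
      then have vk: "v k \<in> fun_vs.span (v ` (I - {k}))"
        unfolding span_family_iff[OF finite_Diff[OF I]]
        by (intro exI[of _ "\<lambda>i. - c i / c k"] allI vk_eq)
      have "v ` I \<subseteq> fun_vs.span (v ` (I - {k}))"
        using vk by (auto intro: fun_vs.span_base)
      then have "fun_vs.span (v ` I) \<subseteq> fun_vs.span (v ` (I - {k}))"
        by (metis fun_vs.span_mono fun_vs.span_span)
      with span have tJ: "t ` J \<subseteq> fun_vs.span (v ` (I - {k}))" by blast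
      have "card (t ` J) \<le> card (v ` (I - {k}))"
        using fun_vs.independent_span_bound[OF finite_imageI[OF finite_Diff[OF I]] ind(2) tJ]
        by (rule conjunct2)
      also have "\<dots> \<le> card (I - {k})" using I by (simp add: card_image_le)
      also have "\<dots> < card I" using I k by (meson card_Diff1_less)
      finally show False using card card_t by simp
    qed
  }
  {
    assume i: "i \<in> I"
    show "v i \<in> fun_vs.span (t ` J)"
    proof (rule ccontr)
      assume n: "v i \<notin> fun_vs.span (t ` J)"
      then have "v i \<notin> t ` J" using fun_vs.span_base by blast
      then have "card (insert (v i) (t ` J)) = Suc (card J)" using J card_t by simp
      moreover have "card (insert (v i) (t ` J)) \<le> card (v ` I)"
      proof -
        have "insert (v i) (t ` J) \<subseteq> fun_vs.span (v ` I)"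
          using span i by (auto intro: fun_vs.span_base)
        from fun_vs.independent_span_bound
            [OF finite_imageI[OF I] fun_vs.independent_insertI[OF n ind(2)] this]
        show ?thesis by (rule conjunct2)
      qed
      moreover have "card (v ` I) \<le> card I" using I by (rule card_image_le)
      ultimately show False using card by simp
    qed
  }
qed

section \<open>Marsden's identity\<close>

text \<open>
  B-splines have local support: both terms of the recursion live on \<open>[\<xi>\<^sub>i, \<xi>\<^bsub>i+q+1\<^esub>)\<close>.
\<close>

lemma bspline_rec_eq_0:
  assumes "mono_on {i..i + q + 1} \<xi>" "x < \<xi> i \<or> \<xi> (i + q + 1) \<le> x"
  shows "bspline_rec \<xi> q i x = 0"
  using assms
proof (induction q arbitrary: i)
  case 0
  then show ?case by auto
next
  case (Suc q)
  have m: "\<xi> i \<le> \<xi> (i + 1)" "\<xi> (i + q + 1) \<le> \<xi> (i + Suc q + 1)"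
    using Suc.prems(1) by (auto intro!: mono_onD[OF Suc.prems(1)])
  have "mono_on {i..i + q + 1} \<xi>" "mono_on {i + 1..i + 1 + q + 1} \<xi>"
    using Suc.prems(1) by (auto elim!: mono_on_subset)
  with Suc.IH[of i] Suc.IH[of "i + 1"] Suc.prems(2) m show ?case
    by (fastforce simp: add.commute)
qed

text \<open>
  The dual polynomial \<open>\<Prod>\<^sub>r (\<xi>\<^bsub>i+r\<^esub> - t)\<close> of Marsden's identity, as a polynomial in \<open>t - z\<close>: a knot
  \<open>\<xi>\<^bsub>i+r\<^esub> = z\<close> contributes a factor divisible by the variable, so multiplicities of \<open>z\<close> can be read off the
  low coefficients.
\<close>

definition dual_poly :: "(nat \<Rightarrow> real) \<Rightarrow> real \<Rightarrow> nat \<Rightarrow> nat \<Rightarrow> real poly" where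
  "dual_poly \<xi> z q i = (\<Prod>r = 1..q. [:\<xi> (i + r) - z, -1:])"

text \<open>
  Induction on the degree. After shifting the index in the second term of the recursion, the factor of
  \<open>B\<^bsub>i,q\<^esub>(x)\<close> is the dual polynomial of degree \<open>q\<close> times the linear interpolation, at \<open>x\<close>, of \<open>\<cdot> - t\<close>
  between the nodes \<open>\<xi>\<^sub>i\<close> and \<open>\<xi>\<^bsub>i+q+1\<^esub>\<close>; interpolation of a linear function returns \<open>x - t\<close>. The sum runs over
  the B-splines that can be nonzero on the knot span \<open>[\<xi>\<^sub>k, \<xi>\<^bsub>k+1\<^esub>)\<close>, so the terms produced at both ends by
  the shift vanish.
\<close>

lemma marsden_identity:
  assumes "mono_on {k - q..k + q + 1} \<xi>" "q < k" "\<xi> k \<le> x" "x < \<xi> (k + 1)"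
  shows "(\<Sum>i = k - q..k. Polynomial.smult (bspline_rec \<xi> q i x) (dual_poly \<xi> z q i)) = [:x - z, -1:] ^ q"
  using assms
proof (induction q)
  case 0
  then show ?case by (simp add: dual_poly_def)
next
  case (Suc q)
  let ?B = "bspline_rec \<xi>" and ?D = "dual_poly \<xi> z"
  define A where "A = k - Suc q"
  have A: "k - q = Suc A" "A \<le> k" "1 \<le> A" "k = A + Suc q" using Suc.prems(2) by (auto simp: A_def)
  have mono: "mono_on {A..k + q + 2} \<xi>" using Suc.prems(1) by (simp add: A_def)
  have mono': "mono_on {i..j} \<xi>" if "A \<le> i" "j \<le> k + q + 2" for i j
    using that by (intro mono_on_subset[OF mono]) auto
  have IH: "(\<Sum>i = Suc A..k. Polynomial.smult (?B q i x) (?D q i)) = [:x - z, -1:] ^ q"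
    using Suc.IH Suc.prems mono' A by simp
  have edge: "?B q A x = 0" "?B q (Suc k) x = 0"
    using Suc.prems(3,4) A by (auto intro!: bspline_rec_eq_0 mono')
  \<comment> \<open>The weights of the linear interpolation at \<open>x\<close> between \<open>\<xi>\<^sub>i\<close> and \<open>\<xi>\<^bsub>i+q+1\<^esub>\<close>.\<close>
  define l where "l i = (x - \<xi> i) / (\<xi> (i + Suc q) - \<xi> i)" for i
  define u where "u i = (\<xi> (i + Suc q) - x) / (\<xi> (i + Suc q) - \<xi> i)" for i
  have rec: "?B (Suc q) i x = l i * ?B q i x + u (Suc i) * ?B q (Suc i) x" for i
    by (simp add: l_def u_def add.commute)
  have gen: "Polynomial.smult c D * (Polynomial.smult d L + Polynomial.smult e U) =
      Polynomial.smult (d * c) (D * L) + Polynomial.smult (e * c) (U * D)"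
    for c d e :: real and D L U
    by (simp add: distrib_left mult.commute)
  have split: "(\<Sum>i = A..k. Polynomial.smult (?B (Suc q) i x) (?D (Suc q) i)) =
      (\<Sum>i = A..k. Polynomial.smult (l i * ?B q i x) (?D (Suc q) i)) +
      (\<Sum>i = A..k. Polynomial.smult (u (Suc i) * ?B q (Suc i) x) (?D (Suc q) i))"
    by (simp only: rec Polynomial.smult_add_left sum.distrib)
  have lower: "(\<Sum>i = A..k. Polynomial.smult (l i * ?B q i x) (?D (Suc q) i)) =
      (\<Sum>i = Suc A..k. Polynomial.smult (l i * ?B q i x) (?D (Suc q) i))"
    using A(2) by (simp only: sum.atLeast_Suc_atMost edge mult_zero_right Polynomial.smult_0_left add_0)
  have "(\<Sum>i = A..k. Polynomial.smult (u (Suc i) * ?B q (Suc i) x) (?D (Suc q) i)) =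
      (\<Sum>i = Suc A..Suc k. Polynomial.smult (u i * ?B q i x) (?D (Suc q) (i - 1)))"
    by (simp only: sum.shift_bounds_cl_Suc_ivl diff_Suc_1)
  also have "\<dots> = (\<Sum>i = Suc A..k. Polynomial.smult (u i * ?B q i x) (?D (Suc q) (i - 1)))"
  proof -
    have "Suc A \<le> Suc k" using A(2) by simp
    then show ?thesis
      by (simp only: sum.nat_ivl_Suc' edge mult_zero_right Polynomial.smult_0_left add_0)
  qed
  finally have upper: "(\<Sum>i = A..k. Polynomial.smult (u (Suc i) * ?B q (Suc i) x) (?D (Suc q) i)) =
      (\<Sum>i = Suc A..k. Polynomial.smult (u i * ?B q i x) (?D (Suc q) (i - 1)))" .
  have "(\<Sum>i = Suc A..k. Polynomial.smult (l i * ?B q i x) (?D (Suc q) i)) +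
      (\<Sum>i = Suc A..k. Polynomial.smult (u i * ?B q i x) (?D (Suc q) (i - 1))) =
     (\<Sum>i = Suc A..k. Polynomial.smult (?B q i x) (?D q i) * [:x - z, -1:])"
    unfolding sum.distrib[symmetric]
  proof (rule sum.cong[OF refl])
    fix i assume i: "i \<in> {Suc A..k}"
    have D1: "?D (Suc q) i = ?D q i * [:\<xi> (i + Suc q) - z, -1:]"
      by (simp add: dual_poly_def)
    have "?D (Suc q) (i - 1) = (\<Prod>r = 0..q. [:\<xi> (i - 1 + Suc r) - z, -1:])"
      unfolding dual_poly_def by (subst prod.shift_bounds_cl_Suc_ivl[symmetric]) simp
    also have "\<dots> = [:\<xi> i - z, -1:] * ?D q i"
      using i by (subst prod.atLeast_Suc_atMost) (auto simp: dual_poly_def)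
    finally have D2: "?D (Suc q) (i - 1) = [:\<xi> i - z, -1:] * ?D q i" .
    show "Polynomial.smult (l i * ?B q i x) (?D (Suc q) i) + Polynomial.smult (u i * ?B q i x) (?D (Suc q) (i - 1)) =
      Polynomial.smult (?B q i x) (?D q i) * [:x - z, -1:]"
    proof (cases "\<xi> i = \<xi> (i + Suc q)")
      case True
      then have "?B q i x = 0"
        using i A by (intro bspline_rec_eq_0 mono') auto
      then show ?thesis by simp
    next
      case False
      then have lu: "l i + u i = 1" "l i * \<xi> (i + Suc q) + u i * \<xi> i = x"
        unfolding l_def u_def by (simp_all add: divide_simps) (simp_all add: algebra_simps)
      have "l i * (\<xi> (i + Suc q) - z) + u i * (\<xi> i - z) =
          (l i * \<xi> (i + Suc q) + u i * \<xi> i) - (l i + u i) * z"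
        by (simp add: algebra_simps)
      also have "\<dots> = x - z" unfolding lu by simp
      finally have "Polynomial.smult (l i) [:\<xi> (i + Suc q) - z, -1:] +
          Polynomial.smult (u i) [:\<xi> i - z, -1:] = [:x - z, - (l i + u i):]"
        by (simp only: smult_pCons add_pCons Polynomial.smult_0_right add_0) simp
      then have "Polynomial.smult (l i) [:\<xi> (i + Suc q) - z, -1:] +
          Polynomial.smult (u i) [:\<xi> i - z, -1:] = [:x - z, -1:]" 
        unfolding lu .
      then have "Polynomial.smult (?B q i x) (?D q i) * [:x - z, -1:] = Polynomial.smult (?B q i x) (?D q i) *
        (Polynomial.smult (l i) [:\<xi> (i + Suc q) - z, -1:] + Polynomial.smult (u i) [:\<xi> i - z, -1:])" by simp
      also have "\<dots> = Polynomial.smult (l i * ?B q i x) (?D (Suc q) i) + Polynomial.smult (u i * ?B q i x) (?D (Suc q) (i - 1))"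
        unfolding D1 D2 by (rule gen)
      finally show ?thesis by simp
    qed
  qed
  also have "\<dots> = [:x - z, -1:] ^ Suc q"
    by (simp only: sum_distrib_right[symmetric] IH power_Suc2)
  finally show ?case unfolding A_def[symmetric] split lower upper .
qed

section \<open>Polynomial coefficients and left limits\<close>

lemma coeff_prod_linear_top:
  fixes f :: "'r \<Rightarrow> real"
  assumes "finite R"
  shows "coeff (\<Prod>r\<in>R. [:f r, -1:]) (card R) = (-1) ^ card R"
proof -
  have "degree (\<Prod>r\<in>R. [:f r, -1:]) = card R"
    using assms by (subst degree_prod_eq_sum_degree) auto
  moreover have "lead_coeff (\<Prod>r\<in>R. [:f r, -1:]) = (-1) ^ card R"
    by (subst lead_coeff_prod) simp
  ultimately show ?thesis by simp
qed

text \<open>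
  Every \<open>r\<close> in \<open>S\<close> contributes a factor \<open>-t\<close>, so the product is divisible by \<open>t\<close> to the power \<open>card S\<close>.
\<close>

lemma coeff_prod_linear_eq_0:
  fixes f :: "'r \<Rightarrow> real"
  assumes "finite R" "S \<subseteq> R" "\<And>r. r \<in> S \<Longrightarrow> f r = 0" "s < card S"
  shows "coeff (\<Prod>r\<in>R. [:f r, -1:]) s = 0"
proof -
  have "(\<Prod>r\<in>R. [:f r, -1:]) = (\<Prod>r\<in>R - S. [:f r, -1:]) * (\<Prod>r\<in>S. [:f r, -1:])"
    using assms by (intro prod.subset_diff)
  also have "(\<Prod>r\<in>S. [:f r, -1:]) = [:0, -1:] ^ card S"
    using assms(3) by simp
  finally have "coeff (\<Prod>r\<in>R. [:f r, -1:]) s =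
      (\<Sum>i\<le>s. coeff (\<Prod>r\<in>R - S. [:f r, -1:]) i * coeff ([:0, -1:] ^ card S) (s - i))"
    by (simp only: coeff_mult)
  also have "\<dots> = 0"
    using assms(4) by (intro sum.neutral) (simp add: coeff_linear_poly_power)
  finally show ?thesis .
qed

text \<open>
  Turns the smoothness conditions at a breakpoint \<open>z\<close> into conditions on coefficients of the polynomial
  recentred at \<open>z\<close>.
\<close>

lemma higher_pderiv_eq_taylor_coeff:
  fixes q :: "real poly"
  shows "poly ((pderiv ^^ l) q) z = fact l * coeff (pcompose q [:z, 1:]) l"
proof -
  have "(pderiv ^^ l) (pcompose q [:z, 1:]) = pcompose ((pderiv ^^ l) q) [:z, 1:]"
    by (induction l) (simp_all add: pderiv_pcompose pderiv_pCons)
  then have "poly ((pderiv ^^ l) q) z = poly ((pderiv ^^ l) (pcompose q [:z, 1:])) 0"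
    by (simp add: poly_pcompose)
  also have "\<dots> = coeff ((pderiv ^^ l) (pcompose q [:z, 1:])) 0"
    by (simp add: poly_0_coeff_0)
  also have "\<dots> = fact l * coeff (pcompose q [:z, 1:]) l"
    by (simp add: coeff_higher_pderiv pochhammer_fact)
  finally show ?thesis .
qed

lemma poly_eq_taylor_sum:
  fixes q :: "real poly"
  assumes "degree q \<le> p"
  shows "poly q x = (\<Sum>l\<le>p. coeff (pcompose q [:z, 1:]) l * (x - z) ^ l)"
proof -
  have "degree (pcompose q [:z, 1:]) \<le> p"
    using degree_pcompose_le[of q "[:z, 1:]"] assms by simp
  then have "pcompose q [:z, 1:] = (\<Sum>l\<le>p. monom (coeff (pcompose q [:z, 1:]) l) l)"
    by (simp add: poly_as_sum_of_monoms')
  then have "poly (pcompose q [:z, 1:]) (x - z) =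
      poly (\<Sum>l\<le>p. monom (coeff (pcompose q [:z, 1:]) l) l) (x - z)" by simp
  then show ?thesis by (simp add: poly_pcompose poly_sum poly_monom)
qed

text \<open>
  The value of a B-spline at the right endpoint is defined by \<open>Lim\<close>, which is meaningful only because the
  limit exists. This is inherited along the recursion from left limits of indicator functions.
\<close>

lemma bspline_rec_left_limit_exists: "\<exists>L. (bspline_rec \<xi> q i \<longlongrightarrow> L) (at_left b)"
proof (induction q arbitrary: i)
  case 0
  show ?case
  proof (cases "\<xi> i < b \<and> b \<le> \<xi> (i + 1)")
    case True
    then have "\<forall>\<^sub>F x in at_left b. bspline_rec \<xi> 0 i x = 1"
      by (auto simp: eventually_at_left_field intro!: exI[of _ "\<xi> i"])
    then show ?thesis by (intro exI[of _ 1] tendsto_eventually)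
  next
    case False
    have "\<forall>\<^sub>F x in at_left b. bspline_rec \<xi> 0 i x = 0"
    proof (cases "\<xi> i < b")
      case True
      with False show ?thesis
        by (auto simp: eventually_at_left_field intro!: exI[of _ "\<xi> (i + 1)"])
    next
      case False
      then show ?thesis
        by (auto simp: eventually_at_left_field intro!: exI[of _ "b - 1"])
    qed
    then show ?thesis by (intro exI[of _ 0] tendsto_eventually)
  qed
next
  case (Suc q)
  obtain L1 L2 where "(bspline_rec \<xi> q i \<longlongrightarrow> L1) (at_left b)"
    "(bspline_rec \<xi> q (i + 1) \<longlongrightarrow> L2) (at_left b)"
    using Suc.IH by blast
  then have "((\<lambda>x. (x - \<xi> i) / (\<xi> (i + Suc q) - \<xi> i) * bspline_rec \<xi> q i x +
     (\<xi> (i + Suc q + 1) - x) / (\<xi> (i + Suc q + 1) - \<xi> (i + 1)) * bspline_rec \<xi> q (i + 1) x) \<longlongrightarrow>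
     (b - \<xi> i) * inverse (\<xi> (i + Suc q) - \<xi> i) * L1 +
     (\<xi> (i + Suc q + 1) - b) * inverse (\<xi> (i + Suc q + 1) - \<xi> (i + 1)) * L2) (at_left b)"
    unfolding divide_inverse by (intro tendsto_intros)
  then have "((\<lambda>x. bspline_rec \<xi> (Suc q) i x) \<longlongrightarrow>
     (b - \<xi> i) * inverse (\<xi> (i + Suc q) - \<xi> i) * L1 +
     (\<xi> (i + Suc q + 1) - b) * inverse (\<xi> (i + Suc q + 1) - \<xi> (i + 1)) * L2) (at_left b)"
    by (simp only: bspline_rec.simps)
  then show ?case by (rule exI)
qed

lemma bspline_tendsto_left: "(bspline_rec \<xi> p i \<longlongrightarrow> bspline b p \<xi> i b) (at_left b)"
proof -
  obtain L where "(bspline_rec \<xi> p i \<longlongrightarrow> L) (at_left b)"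
    using bspline_rec_left_limit_exists by blast
  moreover from this have "bspline b p \<xi> i b = L"
    unfolding bspline_def by (simp add: tendsto_Lim)
  ultimately show ?thesis by simp
qed

section \<open>Truncated powers and the Curry--Schoenberg theorem\<close>

locale knot_sequence =
  fixes a b :: real and n p :: nat and \<xi> :: "nat \<Rightarrow> real"
  assumes ab: "a < b" and open_knots: "open_knot_seq a b n p \<xi>"
begin

abbreviation "knot_set \<equiv> \<xi> ` {1..n + p + 1}"
abbreviation "kmult z \<equiv> knot_mult n p \<xi> z"

lemma p_less_n: "p < n"
  and mono_knots: "mono_on {1..n + p + 1} \<xi>"
  and first_knot: "\<xi> 1 = a"
  and last_knot: "\<xi> (n + p + 1) = b"
  and mult_a: "kmult a = p + 1"
  and mult_b: "kmult b = p + 1"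
  using open_knots by (auto simp: open_knot_seq_def)

lemma knots_le: "1 \<le> i \<Longrightarrow> i \<le> j \<Longrightarrow> j \<le> n + p + 1 \<Longrightarrow> \<xi> i \<le> \<xi> j"
  using mono_knots by (auto intro: mono_onD)

lemma mono_knots_sub: "1 \<le> i \<Longrightarrow> j \<le> n + p + 1 \<Longrightarrow> mono_on {i..j} \<xi>"
  by (rule mono_on_subset[OF mono_knots]) auto

lemma knots_range: "1 \<le> i \<Longrightarrow> i \<le> n + p + 1 \<Longrightarrow> a \<le> \<xi> i \<and> \<xi> i \<le> b"
  using knots_le[of 1 i] knots_le[of i "n + p + 1"] first_knot last_knot by auto

lemma mult_le: "z \<in> knot_set \<Longrightarrow> kmult z \<le> p + 1"
proof -
  assume "z \<in> knot_set"
  then have "z = a \<or> z = b \<or> z \<in> {a<..<b}" using knots_range by fastforce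
  then show ?thesis using open_knots by (auto simp: open_knot_seq_def)
qed

lemma a_in_knots: "a \<in> knot_set" and b_in_knots: "b \<in> knot_set"
  using first_knot last_knot by force+

text \<open>
  By monotonicity the knots equal to \<open>a\<close> come first, and there are \<open>p + 1\<close> of them.
\<close>

lemma knot_eq_a: "\<xi> (p + 1) = a"
proof (rule ccontr)
  assume ne: "\<xi> (p + 1) \<noteq> a"
  have "{i \<in> {1..n + p + 1}. \<xi> i = a} \<subseteq> {1..p}"
  proof
    fix i assume i: "i \<in> {i \<in> {1..n + p + 1}. \<xi> i = a}"
    have "\<not> p + 1 \<le> i"
      using i ne knots_le[of "p + 1" i] knots_range[of "p + 1"] p_less_n by force
    then show "i \<in> {1..p}" using i by auto
  qed
  then have "kmult a \<le> card {1..p}"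
    unfolding knot_mult_def by (intro card_mono) auto
  then show False using mult_a by simp
qed

lemma knot_eq_b: "\<xi> (n + 1) = b"
proof (rule ccontr)
  assume ne: "\<xi> (n + 1) \<noteq> b"
  have "{i \<in> {1..n + p + 1}. \<xi> i = b} \<subseteq> {n + 2..n + p + 1}"
  proof
    fix i assume i: "i \<in> {i \<in> {1..n + p + 1}. \<xi> i = b}"
    have "\<not> i \<le> n + 1"
      using i ne knots_le[of i "n + 1"] knots_range[of "n + 1"] by force
    then show "i \<in> {n + 2..n + p + 1}" using i by auto
  qed
  then have "kmult b \<le> card {n + 2..n + p + 1}"
    unfolding knot_mult_def by (intro card_mono) auto
  then show False using mult_b by simp
qed

text \<open>
  Openness of the knot sequence places the span of \<open>x\<close> in \<open>{p + 1..n}\<close>, which is what the local form of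
  Marsden's identity needs.
\<close>

lemma locate_knot_span:
  assumes "a \<le> x" "x < b"
  obtains k where "p < k" "k \<le> n" "\<xi> k \<le> x" "x < \<xi> (k + 1)"
proof -
  define S where "S = {i \<in> {1..n + p + 1}. \<xi> i \<le> x}"
  define k where "k = Max S"
  have S: "finite S" "p + 1 \<in> S" using assms knot_eq_a p_less_n by (auto simp: S_def)
  have kS: "k \<in> S" unfolding k_def using S by (intro Max_in) auto
  have pk: "p + 1 \<le> k" unfolding k_def using S by (intro Max_ge)
  have kn: "k \<le> n"
  proof (rule ccontr)
    assume "\<not> k \<le> n"
    then have "b \<le> \<xi> k" using kS knots_le[of "n + 1" k] knot_eq_b by (auto simp: S_def)
    then show False using kS assms by (auto simp: S_def)
  qed
  have "x < \<xi> (k + 1)"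
  proof (rule ccontr)
    assume "\<not> x < \<xi> (k + 1)"
    then have "k + 1 \<in> S" using kn p_less_n by (auto simp: S_def)
    then have "k + 1 \<le> k" unfolding k_def using S by (intro Max_ge)
    then show False by simp
  qed
  with that[of k] pk kn kS show thesis by (auto simp: S_def)
qed

lemma marsden_on_interval:
  assumes "a \<le> x" "x < b"
  shows "(\<Sum>i = 1..n. Polynomial.smult (bspline_rec \<xi> p i x) (dual_poly \<xi> z p i)) = [:x - z, -1:] ^ p"
proof -
  obtain k where k: "p < k" "k \<le> n" "\<xi> k \<le> x" "x < \<xi> (k + 1)"
    using locate_knot_span assms by blast
  have "bspline_rec \<xi> p i x = 0" if i: "i \<in> {1..n} - {k - p..k}" for i
  proof (rule bspline_rec_eq_0)
    show "mono_on {i..i + p + 1} \<xi>" using i by (intro mono_knots_sub) auto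
    show "x < \<xi> i \<or> \<xi> (i + p + 1) \<le> x"
    proof (cases "k < i")
      case True
      then show ?thesis using k i knots_le[of "k + 1" i] by auto
    next
      case False
      then have "i + p + 1 \<le> k" using i k by auto
      then show ?thesis using k i knots_le[of "i + p + 1" k] by auto
    qed
  qed
  then have "(\<Sum>i = 1..n. Polynomial.smult (bspline_rec \<xi> p i x) (dual_poly \<xi> z p i)) =
      (\<Sum>i = k - p..k. Polynomial.smult (bspline_rec \<xi> p i x) (dual_poly \<xi> z p i))"
    using k by (intro sum.mono_neutral_right) auto
  also have "\<dots> = [:x - z, -1:] ^ p"
    using k p_less_n by (intro marsden_identity mono_knots_sub) auto
  finally show ?thesis .
qed

definition trunc_pow :: "real \<times> nat \<Rightarrow> real \<Rightarrow> real" where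
  "trunc_pow = (\<lambda>(z, l) x. if x \<in> {a..b} \<and> z \<le> x then (x - z) ^ l else 0)"

text \<open>
  A spline may have jumps in its \<open>l\<close>-th derivative at \<open>z\<close> exactly if \<open>l + m(z) > p\<close>. The left endpoint,
  with multiplicity \<open>p + 1\<close>, contributes the exponents \<open>0, \<dots>, p\<close>, that is, all polynomials.
\<close>

definition trunc_index :: "(real \<times> nat) set" where
  "trunc_index = Sigma (knot_set - {b}) (\<lambda>z. {p + 1 - kmult z..p})"

text \<open>
  Restrictions to \<open>[a, b]\<close>, extended by zero, because the members of the spline space vanish outside
  \<open>[a, b]\<close> whereas the B-splines are unconstrained there.
\<close>

definition restricted_bspline :: "nat \<Rightarrow> real \<Rightarrow> real" where
  "restricted_bspline i x = (if x \<in> {a..b} then bspline b p \<xi> i x else 0)"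

definition restricted_aux :: "nat \<Rightarrow> real \<Rightarrow> real" where
  "restricted_aux i x = (if x \<in> {a..b} then aux_bspline b p \<xi> i x else 0)"

lemma finite_trunc_index: "finite trunc_index"
  by (auto simp: trunc_index_def)

text \<open>
  The number of truncated powers is the number \<open>n + p + 1\<close> of knots minus the multiplicity \<open>p + 1\<close> of \<open>b\<close>.
\<close>

lemma card_trunc_index: "card trunc_index = n"
proof -
  have card_eq: "card {p + 1 - kmult z..p} = kmult z" if "z \<in> knot_set - {b}" for z
    using that mult_le[of z] by simp
  have "card trunc_index = (\<Sum>z\<in>knot_set - {b}. card {p + 1 - kmult z..p})"
    unfolding trunc_index_def by (rule card_SigmaI) auto
  also have "\<dots> = (\<Sum>z\<in>knot_set - {b}. kmult z)"
    by (rule sum.cong[OF refl card_eq])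
  also have "\<dots> = (\<Sum>z\<in>knot_set. kmult z) - kmult b"
    using b_in_knots by (subst sum_diff1_nat) auto
  also have "(\<Sum>z\<in>knot_set. kmult z) = n + p + 1"
    using sum.image_gen[of "{1..n + p + 1}" "\<lambda>_. 1::nat" \<xi>] by (simp add: knot_mult_def)
  finally show ?thesis using mult_b by simp
qed

text \<open>
  Compare the coefficients of \<open>t\<^sup>s\<close> with \<open>s = p - l < m(z)\<close> in Marsden's identity centred at \<open>z\<close>, but keep
  only the B-splines with \<open>z \<le> \<xi>\<^sub>i\<close>. To the left of \<open>z\<close> all of these vanish. To the right of \<open>z\<close> nothing is
  lost: a discarded B-spline either ends before \<open>z\<close>, or all knots equal to \<open>z\<close> are among its interior knots
  \<open>\<xi>\<^bsub>i+1\<^esub>, \<dots>, \<xi>\<^bsub>i+p\<^esub>\<close>, and then its dual polynomial has no term \<open>t\<^sup>s\<close>. The endpoint \<open>b\<close> follows by taking left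
  limits.
\<close>

lemma trunc_pow_eq_bspline_sum:
  assumes z: "(z, l) \<in> trunc_index" and x: "x \<in> {a..b}"
  shows "(\<Sum>i = 1..n. (if z \<le> \<xi> i then coeff (dual_poly \<xi> z p i) (p - l) else 0) * restricted_bspline i x)
      = (p choose (p - l)) * (-1) ^ (p - l) * trunc_pow (z, l) x"
proof -
  let ?s = "p - l"
  let ?c = "\<lambda>i. if z \<le> \<xi> i then coeff (dual_poly \<xi> z p i) ?s else 0"
  let ?C = "(p choose ?s) * (-1) ^ ?s :: real"
  have zK: "z \<in> knot_set" "z \<noteq> b" and l: "l \<le> p" "?s < kmult z" and zb: "z < b" "a \<le> z"
    using z knots_range mult_le by (fastforce simp: trunc_index_def)+
  have main: "(\<Sum>i = 1..n. ?c i * bspline_rec \<xi> p i x) = (if z \<le> x then ?C * (x - z) ^ l else 0)"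
    if x: "a \<le> x" "x < b" for x
  proof (cases "z \<le> x")
    case False
    have "?c i * bspline_rec \<xi> p i x = 0" if "i \<in> {1..n}" for i
      using False that by (auto intro!: bspline_rec_eq_0 mono_knots_sub)
    then show ?thesis using False by (simp add: sum.neutral)
  next
    case True
    have "?c i * bspline_rec \<xi> p i x = coeff (dual_poly \<xi> z p i) ?s * bspline_rec \<xi> p i x"
      if i: "i \<in> {1..n}" for i
    proof (cases "z \<le> \<xi> i")
      case False
      have "bspline_rec \<xi> p i x = 0 \<or> coeff (dual_poly \<xi> z p i) ?s = 0"
      proof (cases "\<xi> (i + p + 1) \<le> z")
        case True
        then show ?thesis using \<open>z \<le> x\<close> i by (auto intro!: bspline_rec_eq_0 mono_knots_sub)
      next
        case z_less: False
        let ?L = "{j \<in> {1..n + p + 1}. \<xi> j = z}"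
        have sub: "i < j \<and> j \<le> i + p" if j: "j \<in> ?L" for j
        proof -
          have "\<not> j \<le> i" using j False i knots_le[of j i] by auto
          moreover have "\<not> i + p + 1 \<le> j" using j z_less i knots_le[of "i + p + 1" j] by auto
          ultimately show ?thesis by auto
        qed
        have "card ((\<lambda>j. j - i) ` ?L) = kmult z"
          unfolding knot_mult_def using sub
          by (intro card_image inj_onI) (metis (no_types, lifting) less_imp_le_nat eq_diff_iff)
        then have "coeff (dual_poly \<xi> z p i) ?s = 0"
          unfolding dual_poly_def using l sub
          by (intro coeff_prod_linear_eq_0[where S = "(\<lambda>j. j - i) ` ?L"]) fastforce+
        then show ?thesis by blast
      qed
      then show ?thesis using False by auto
    qed simp
    then have "(\<Sum>i = 1..n. ?c i * bspline_rec \<xi> p i x) =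
        (\<Sum>i = 1..n. coeff (dual_poly \<xi> z p i) ?s * bspline_rec \<xi> p i x)"
      by (rule sum.cong[OF refl])
    also have "\<dots> = coeff (\<Sum>i = 1..n. Polynomial.smult (bspline_rec \<xi> p i x) (dual_poly \<xi> z p i)) ?s"
      by (simp add: coeff_sum mult.commute)
    also have "\<dots> = ?C * (x - z) ^ l"
      unfolding marsden_on_interval[OF x] using l by (simp add: coeff_linear_poly_power)
    finally show ?thesis using True by simp
  qed
  show ?thesis
  proof (cases "x = b")
    case False
    then show ?thesis
      using main[of x] x by (simp add: restricted_bspline_def bspline_def trunc_pow_def)
  next
    case True
    have "((\<lambda>x. \<Sum>i = 1..n. ?c i * bspline_rec \<xi> p i x) \<longlongrightarrow> (\<Sum>i = 1..n. ?c i * bspline b p \<xi> i b)) (at_left b)"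
      by (intro tendsto_intros bspline_tendsto_left)
    moreover have "((\<lambda>x. \<Sum>i = 1..n. ?c i * bspline_rec \<xi> p i x) \<longlongrightarrow> ?C * (b - z) ^ l) (at_left b)"
    proof (rule Lim_transform_eventually)
      show "((\<lambda>x. ?C * (x - z) ^ l) \<longlongrightarrow> ?C * (b - z) ^ l) (at_left b)"
        by (intro tendsto_intros)
      show "\<forall>\<^sub>F x in at_left b. ?C * (x - z) ^ l = (\<Sum>i = 1..n. ?c i * bspline_rec \<xi> p i x)"
        unfolding eventually_at_left_field
      proof (intro exI[of _ z] conjI allI impI)
        fix x assume "z < x" "x < b"
        then show "?C * (x - z) ^ l = (\<Sum>i = 1..n. ?c i * bspline_rec \<xi> p i x)"
          using main[of x] zb by auto
      qed (use zb in auto)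
    qed
    ultimately have "(\<Sum>i = 1..n. ?c i * bspline b p \<xi> i b) = ?C * (b - z) ^ l"
      by (rule tendsto_unique[OF trivial_limit_at_left_real])
    then show ?thesis
      using True ab zb by (simp add: restricted_bspline_def trunc_pow_def)
  qed
qed

text \<open>
  The case \<open>z = a\<close>, \<open>l = 0\<close>: the coefficients involved are the leading coefficients \<open>(-1)\<^sup>p\<close> of the dual
  polynomials.
\<close>

lemma partition_of_unity:
  assumes "x \<in> {a..b}"
  shows "(\<Sum>i = 1..n. restricted_bspline i x) = 1"
proof -
  have ia: "(a, 0) \<in> trunc_index" using a_in_knots ab mult_a by (auto simp: trunc_index_def)
  have c: "(if a \<le> \<xi> i then coeff (dual_poly \<xi> a p i) (p - 0) else 0) = (-1) ^ p"
    if "i \<in> {1..n}" for i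
    using that knots_range[of i] coeff_prod_linear_top[of "{1..p}" "\<lambda>r. \<xi> (i + r) - a"]
    by (simp add: dual_poly_def)
  have "(\<Sum>i = 1..n. (-1) ^ p * restricted_bspline i x) = (-1) ^ p * trunc_pow (a, 0) x"
    using trunc_pow_eq_bspline_sum[OF ia assms] c by simp
  then show ?thesis
    using assms by (simp add: sum_distrib_left[symmetric] trunc_pow_def)
qed

text \<open>
  Replacing \<open>B\<^sub>1\<close> by the constant \<open>1\<close> does not shrink the span, since the B-splines sum to \<open>1\<close>.
\<close>

lemma restricted_bspline_in_span:
  assumes "i \<in> {1..n}"
  shows "restricted_bspline i \<in> fun_vs.span (restricted_aux ` {1..n})"
proof (cases "i = 1")
  case False
  then have "restricted_bspline i = restricted_aux i"
    by (auto simp: restricted_bspline_def restricted_aux_def aux_bspline_def fun_eq_iff)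
  then show ?thesis using assms by (auto intro: fun_vs.span_base)
next
  case True
  have "restricted_bspline 1 = restricted_aux 1 - (\<Sum>i = 2..n. restricted_aux i)"
  proof
    fix x
    have s: "(\<Sum>i = 2..n. restricted_aux i x) = (\<Sum>i = 2..n. restricted_bspline i x)"
      by (intro sum.cong) (auto simp: restricted_bspline_def restricted_aux_def aux_bspline_def)
    have "(\<Sum>i = 1..n. restricted_bspline i x) = restricted_bspline 1 x + (\<Sum>i = 2..n. restricted_bspline i x)"
      using assms by (subst sum.atLeast_Suc_atMost) (auto simp: numeral_2_eq_2)
    then show "restricted_bspline 1 x = (restricted_aux 1 - (\<Sum>i = 2..n. restricted_aux i)) x"
      using partition_of_unity[of x]
      by (cases "x \<in> {a..b}")
        (auto simp: sum_fun_apply s restricted_aux_def[of "Suc 0"] aux_bspline_def restricted_bspline_def)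
  qed
  also have "\<dots> \<in> fun_vs.span (restricted_aux ` {1..n})"
    using p_less_n by (intro fun_vs.span_diff fun_vs.span_sum fun_vs.span_base) auto
  finally show ?thesis using True by simp
qed

lemma trunc_pow_in_span:
  assumes "j \<in> trunc_index"
  shows "trunc_pow j \<in> fun_vs.span (restricted_aux ` {1..n})"
proof -
  obtain z l where j: "j = (z, l)" by (cases j)
  let ?c = "\<lambda>i. if z \<le> \<xi> i then coeff (dual_poly \<xi> z p i) (p - l) else 0"
  let ?C = "(p choose (p - l)) * (-1) ^ (p - l) :: real"
  have C: "?C \<noteq> 0" by simp
  have "trunc_pow j = (\<Sum>i = 1..n. (\<lambda>x. (?c i / ?C) * restricted_bspline i x))"
  proof
    fix x
    show "trunc_pow j x = (\<Sum>i = 1..n. (\<lambda>x. (?c i / ?C) * restricted_bspline i x)) x"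
    proof (cases "x \<in> {a..b}")
      case True
      have "trunc_pow j x = (\<Sum>i = 1..n. ?c i * restricted_bspline i x) / ?C"
        unfolding trunc_pow_eq_bspline_sum[OF assms[unfolded j] True] using C by (simp add: j)
      also have "\<dots> = (\<Sum>i = 1..n. (?c i / ?C) * restricted_bspline i x)"
        by (simp add: sum_divide_distrib)
      finally show ?thesis by (simp only: sum_fun_apply)
    next
      case False
      then have "trunc_pow j x = 0" "restricted_bspline i x = 0" for i
        by (auto simp: restricted_bspline_def trunc_pow_def j)
      then show ?thesis by (simp only: sum_fun_apply mult_zero_right sum.neutral_const)
    qed
  qed
  also have "\<dots> \<in> fun_vs.span (restricted_aux ` {1..n})"
    by (intro fun_vs.span_sum fun_vs.span_scale restricted_bspline_in_span)
  finally show ?thesis .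
qed

text \<open>
  At the smallest knot \<open>z0\<close> carrying a nonzero coefficient, only the powers attached to \<open>z0\<close> act up to the
  next knot, so there the combination is a polynomial in \<open>x - z0\<close>. Infinitely many zeros force it to
  vanish. Only infinitely many zeros per interval, instead of vanishing everywhere, are assumed: a
  function that is zero almost surely satisfies this.
\<close>

lemma trunc_pow_independent:
  assumes D: "\<And>u v. a \<le> u \<Longrightarrow> u < v \<Longrightarrow> v \<le> b \<Longrightarrow>
      infinite {x \<in> {u<..<v}. (\<Sum>j\<in>trunc_index. c j * trunc_pow j x) = 0}"
  shows "\<forall>j\<in>trunc_index. c j = 0"
proof (rule ccontr)
  assume "\<not> (\<forall>j\<in>trunc_index. c j = 0)"
  then obtain z' l' where zl: "(z', l') \<in> trunc_index" "c (z', l') \<noteq> 0" by auto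
  define Z where "Z = {z. \<exists>l. (z, l) \<in> trunc_index \<and> c (z, l) \<noteq> 0}"
  have ZK: "Z \<subseteq> knot_set - {b}" by (auto simp: Z_def trunc_index_def)
  then have Zf: "finite Z" by (rule finite_subset) auto
  define z0 where "z0 = Min Z"
  have z0: "z0 \<in> Z" unfolding z0_def using Zf zl by (intro Min_in) (auto simp: Z_def)
  have z0_le: "z0 \<le> z" if "z \<in> Z" for z unfolding z0_def using Zf that by (intro Min_le)
  have z0_range: "a \<le> z0" "z0 < b" and z0K: "z0 \<in> knot_set - {b}"
    using z0 ZK knots_range by (fastforce)+
  define N where "N = {z \<in> knot_set. z0 < z}"
  define z1 where "z1 = Min N"
  have N: "finite N" "b \<in> N" using z0_range b_in_knots by (auto simp: N_def)
  have z1: "z1 \<in> N" unfolding z1_def using N by (intro Min_in) auto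
  have z1_le: "z1 \<le> z" if "z \<in> knot_set" "z0 < z" for z
    unfolding z1_def using N that by (intro Min_le) (auto simp: N_def)
  let ?c = "\<lambda>l. if (z0, l) \<in> trunc_index then c (z0, l) else 0"
  define q where "q = (\<Sum>l\<le>p. monom (?c l) l)"
  have eq: "(\<Sum>j\<in>trunc_index. c j * trunc_pow j x) = poly q (x - z0)" if x: "x \<in> {z0<..<z1}" for x
  proof -
    have xab: "x \<in> {a..b}" using x z0_range z1_le[OF b_in_knots] by auto
    have "(\<Sum>j\<in>trunc_index. c j * trunc_pow j x) =
        (\<Sum>z\<in>knot_set - {b}. \<Sum>l\<in>{p + 1 - kmult z..p}. c (z, l) * trunc_pow (z, l) x)"
      unfolding trunc_index_def by (subst sum.Sigma) (auto simp: case_prod_beta)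
    also have "\<dots> = (\<Sum>z\<in>{z0}. \<Sum>l\<in>{p + 1 - kmult z..p}. c (z, l) * trunc_pow (z, l) x)"
    proof (rule sum.mono_neutral_right)
      show "{z0} \<subseteq> knot_set - {b}" using z0K by auto
      show "\<forall>z\<in>knot_set - {b} - {z0}. (\<Sum>l\<in>{p + 1 - kmult z..p}. c (z, l) * trunc_pow (z, l) x) = 0"
      proof (intro ballI sum.neutral)
        fix z l assume z: "z \<in> knot_set - {b} - {z0}" and l: "l \<in> {p + 1 - kmult z..p}"
        show "c (z, l) * trunc_pow (z, l) x = 0"
        proof (cases "z < z0")
          case True
          then have "z \<notin> Z" using z0_le by force
          moreover have "(z, l) \<in> trunc_index" using z l by (auto simp: trunc_index_def)
          ultimately show ?thesis by (auto simp: Z_def)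
        next
          case False
          then have "z1 \<le> z" using z z1_le by auto
          then show ?thesis using x by (auto simp: trunc_pow_def)
        qed
      qed
    qed auto
    also have "\<dots> = (\<Sum>l\<in>{p + 1 - kmult z0..p}. ?c l * (x - z0) ^ l)"
      using x z0K xab by (auto intro!: sum.cong simp: trunc_pow_def trunc_index_def)
    also have "\<dots> = (\<Sum>l\<le>p. ?c l * (x - z0) ^ l)"
      by (rule sum.mono_neutral_left) (auto simp: trunc_index_def)
    also have "\<dots> = poly q (x - z0)" by (simp add: q_def poly_sum poly_monom)
    finally show ?thesis .
  qed
  have "infinite {x \<in> {z0<..<z1}. (\<Sum>j\<in>trunc_index. c j * trunc_pow j x) = 0}"
    using z0_range z1 z1_le[OF b_in_knots] by (intro D) (auto simp: N_def)
  also have "{x \<in> {z0<..<z1}. (\<Sum>j\<in>trunc_index. c j * trunc_pow j x) = 0} =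
     {x \<in> {z0<..<z1}. poly q (x - z0) = 0}"
    using eq by auto
  finally have inf: "infinite {x \<in> {z0<..<z1}. poly q (x - z0) = 0}" .
  have "q = 0"
  proof (rule ccontr)
    assume "q \<noteq> 0"
    then have "finite ((\<lambda>y. y + z0) ` {y. poly q y = 0})" using poly_roots_finite by blast
    moreover have "{x \<in> {z0<..<z1}. poly q (x - z0) = 0} \<subseteq> (\<lambda>y. y + z0) ` {y. poly q y = 0}"
      by (auto intro!: image_eqI[where x = "_ - z0"])
    ultimately show False using inf finite_subset by blast
  qed
  moreover from z0 obtain l where l: "(z0, l) \<in> trunc_index" "c (z0, l) \<noteq> 0" by (auto simp: Z_def)
  moreover have "coeff q l = c (z0, l)"
    using l by (auto simp: q_def coeff_sum trunc_index_def)
  ultimately show False by simp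
qed

lemma trunc_pow_independent_family:
  assumes "\<forall>x. (\<Sum>j\<in>trunc_index. c j * trunc_pow j x) = 0"
  shows "\<forall>j\<in>trunc_index. c j = 0"
proof (rule trunc_pow_independent)
  fix u v :: real assume "u < v"
  then show "infinite {x \<in> {u<..<v}. (\<Sum>j\<in>trunc_index. c j * trunc_pow j x) = 0}"
    using infinite_Ioo[of u v] assms by (simp only: simp_thms Collect_mem_eq)
qed

lemma span_aux_eq_span_trunc:
  "fun_vs.span (restricted_aux ` {1..n}) = fun_vs.span (trunc_pow ` trunc_index)"
proof (rule fun_vs.span_eq[THEN iffD2], intro conjI subsetI)
  fix h assume "h \<in> restricted_aux ` {1..n}"
  then obtain i where i: "i \<in> {1..n}" "h = restricted_aux i" by blast
  show "h \<in> fun_vs.span (trunc_pow ` trunc_index)"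
    unfolding i(2)
    by (rule steinitz_families(2)[OF _ finite_trunc_index _ trunc_pow_independent_family trunc_pow_in_span i(1)])
      (simp_all add: card_trunc_index)
next
  fix h assume "h \<in> trunc_pow ` trunc_index"
  then show "h \<in> fun_vs.span (restricted_aux ` {1..n})" using trunc_pow_in_span by blast
qed

text \<open>
  Independence in the form needed for the Gram matrix. The zeros are transferred to the expansion in
  truncated powers, which is therefore trivial; then the combination vanishes identically and
  independence of the spanning family applies.
\<close>

lemma restricted_aux_independent:
  assumes D: "\<And>u v. a \<le> u \<Longrightarrow> u < v \<Longrightarrow> v \<le> b \<Longrightarrow>
      infinite {x \<in> {u<..<v}. (\<Sum>i = 1..n. c i * restricted_aux i x) = 0}"
  shows "\<forall>i\<in>{1..n}. c i = 0"
proof -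
  define h where "h x = (\<Sum>i = 1..n. c i * restricted_aux i x)" for x
  have "h \<in> fun_vs.span (restricted_aux ` {1..n})"
    by (subst span_family_iff) (auto simp: h_def)
  then obtain d where d: "\<And>x. h x = (\<Sum>j\<in>trunc_index. d j * trunc_pow j x)"
    unfolding span_aux_eq_span_trunc span_family_iff[OF finite_trunc_index] by blast
  have "\<forall>j\<in>trunc_index. d j = 0"
  proof (rule trunc_pow_independent)
    fix u v assume "a \<le> u" "u < v" "v \<le> b"
    then have "infinite {x \<in> {u<..<v}. h x = 0}" unfolding h_def by (rule D)
    then show "infinite {x \<in> {u<..<v}. (\<Sum>j\<in>trunc_index. d j * trunc_pow j x) = 0}"
      unfolding d .
  qed
  then have z: "\<forall>x. (\<Sum>i = 1..n. c i * restricted_aux i x) = 0" using d by (simp add: h_def)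
  show ?thesis
    by (rule steinitz_families(1)[OF _ finite_trunc_index _ trunc_pow_independent_family trunc_pow_in_span z])
      (simp_all add: card_trunc_index)
qed

text \<open>
  Names for the \<open>r\<close> and \<open>\<zeta>\<^sub>j\<close> of the knot sequence; the subintervals of the piecewise polynomials are
  \<open>[\<zeta>\<^sub>j, \<zeta>\<^bsub>j+1\<^esub>)\<close> for \<open>1 \<le> j \<le> r - 1\<close>.
\<close>

abbreviation "num_bp \<equiv> num_knots n p \<xi>"
abbreviation "\<zeta> \<equiv> knot_val n p \<xi>"

lemma breakpoints_strict_mono: "1 \<le> i \<Longrightarrow> i < j \<Longrightarrow> j \<le> num_bp \<Longrightarrow> \<zeta> i < \<zeta> j"
  unfolding knot_val_def num_knots_def
  by (rule sorted_wrt_nth_less[OF strict_sorted_list_of_set]) auto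

lemma breakpoints_le_iff:
  assumes "i \<in> {1..num_bp}" "j \<in> {1..num_bp}" shows "\<zeta> i \<le> \<zeta> j \<longleftrightarrow> i \<le> j"
  using breakpoints_strict_mono[of i j] breakpoints_strict_mono[of j i] assms
  by (cases i j rule: linorder_cases) auto

lemma breakpoints_image: "\<zeta> ` {1..num_bp} = knot_set"
proof -
  define L where "L = sorted_list_of_set knot_set"
  have L: "set L = knot_set" "length L = num_bp" by (simp_all add: L_def num_knots_def)
  have \<zeta>: "\<zeta> (Suc i) = L ! i" for i by (simp add: knot_val_def L_def)
  have "\<zeta> ` {1..num_bp} = \<zeta> ` (Suc ` {..<num_bp})" by (simp only: image_Suc_lessThan)
  also have "\<dots> = (\<lambda>i. L ! i) ` {..<num_bp}" by (simp only: image_image \<zeta>)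
  also have "\<dots> = set L" by (auto simp: set_conv_nth L)
  finally show ?thesis by (simp only: L)
qed

lemma two_breakpoints: "2 \<le> num_bp"
proof -
  have "card {a, b} \<le> num_bp" unfolding num_knots_def
    using a_in_knots b_in_knots by (intro card_mono) auto
  then show ?thesis using ab by simp
qed

lemma breakpoint_first: "\<zeta> 1 = a"
proof -
  obtain j where j: "j \<in> {1..num_bp}" "\<zeta> j = a" using a_in_knots breakpoints_image by (metis imageE)
  have "\<zeta> 1 \<in> knot_set" using breakpoints_image two_breakpoints by auto
  then have "a \<le> \<zeta> 1" using knots_range by auto
  moreover have "\<zeta> 1 \<le> \<zeta> j" using breakpoints_le_iff[of 1 j] j by auto
  ultimately show ?thesis using j by simp
qed

lemma breakpoint_last: "\<zeta> num_bp = b"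
proof -
  obtain j where j: "j \<in> {1..num_bp}" "\<zeta> j = b" using b_in_knots breakpoints_image by (metis imageE)
  have "\<zeta> num_bp \<in> knot_set" using breakpoints_image two_breakpoints by auto
  then have "\<zeta> num_bp \<le> b" using knots_range by auto
  moreover have "\<zeta> j \<le> \<zeta> num_bp" using breakpoints_le_iff[of j num_bp] j by auto
  ultimately show ?thesis using j by simp
qed

lemma breakpoints_range: "j \<in> {1..num_bp} \<Longrightarrow> \<zeta> j \<in> {a..b}"
proof -
  assume "j \<in> {1..num_bp}"
  then have "\<zeta> j \<in> knot_set" using breakpoints_image by blast
  then show "\<zeta> j \<in> {a..b}" using knots_range by auto
qed

lemma breakpoints_image_initial: "\<zeta> ` {1..num_bp - 1} = knot_set - {b}"
proof -
  have "{1..num_bp} = insert num_bp {1..num_bp - 1}" using two_breakpoints by auto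
  then have "knot_set = insert b (\<zeta> ` {1..num_bp - 1})"
    using breakpoints_image breakpoint_last by (metis image_insert)
  moreover have "b \<notin> \<zeta> ` {1..num_bp - 1}"
    using breakpoints_strict_mono[of _ num_bp] breakpoint_last by force
  ultimately show ?thesis by auto
qed

lemma locate_breakpoint_span:
  assumes "a \<le> x" "x < b"
  obtains j where "j \<in> {1..num_bp - 1}" "x \<in> {\<zeta> j..<\<zeta> (j + 1)}"
proof -
  define S where "S = {j \<in> {1..num_bp}. \<zeta> j \<le> x}"
  have S: "finite S" "1 \<in> S" using breakpoint_first assms two_breakpoints by (auto simp: S_def)
  define j where "j = Max S"
  have j: "j \<in> S" unfolding j_def using S by (intro Max_in) auto
  have "j \<noteq> num_bp" using j assms breakpoint_last by (auto simp: S_def)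
  then have j': "j \<in> {1..num_bp - 1}" using j by (auto simp: S_def)
  have "\<not> \<zeta> (j + 1) \<le> x"
  proof
    assume "\<zeta> (j + 1) \<le> x"
    then have "j + 1 \<in> S" using j' by (auto simp: S_def)
    then have "j + 1 \<le> j" unfolding j_def using S by (intro Max_ge)
    then show False by simp
  qed
  then show thesis using j j' by (intro that[of j]) (auto simp: S_def)
qed

text \<open>
  The two polynomial pieces differ only across the breakpoint \<open>z\<close>, where \<open>(x - z)\<^sup>l\<close> has vanishing
  derivatives of all orders below \<open>l\<close>.
\<close>

lemma trunc_pow_in_spline_space:
  assumes "t \<in> trunc_index"
  shows "trunc_pow t \<in> spline_space a b n p \<xi>"
proof -
  obtain z l where t: "t = (z, l)" by (cases t)
  have zl: "z \<in> knot_set - {b}" "l \<le> p" "p < l + kmult z"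
    using assms by (auto simp: t trunc_index_def)
  then obtain i where i: "i \<in> {1..num_bp - 1}" "z = \<zeta> i"
    using breakpoints_image_initial by (metis imageE)
  define P where "P j = (if i \<le> j then [:- z, 1:] ^ l else 0 :: real poly)" for j
  have poly_P: "poly (P j) x = (if i \<le> j then (x - z) ^ l else 0)" for j x
    by (simp add: P_def poly_power)
  show ?thesis unfolding spline_space_def mem_Collect_eq
  proof (intro conjI exI[of _ P] ballI allI impI)
    fix x assume "x \<notin> {a..b}"
    then show "trunc_pow t x = 0" by (auto simp: t trunc_pow_def)
  next
    fix j assume j: "j \<in> {1..num_bp - 1}"
    show "degree (P j) \<le> p"
      using zl degree_power_le[of "[:- z, 1:]" l] by (simp add: P_def)
    fix x assume x: "x \<in> {\<zeta> j..<\<zeta> (j + 1)}"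
    have "j \<in> {1..num_bp}" "j + 1 \<in> {1..num_bp}" using j by auto
    then have xab: "x \<in> {a..b}"
      using x breakpoints_range[of j] breakpoints_range[of "j + 1"] by auto
    have "z \<le> x \<longleftrightarrow> i \<le> j"
    proof
      assume "z \<le> x"
      then have "\<not> \<zeta> (j + 1) \<le> \<zeta> i" using x i by auto
      moreover have "j + 1 \<in> {1..num_bp}" "i \<in> {1..num_bp}" using i j by auto
      ultimately have "\<not> j + 1 \<le> i" using breakpoints_le_iff[of "j + 1" i] by blast
      then show "i \<le> j" by simp
    next
      assume "i \<le> j"
      then have "\<zeta> i \<le> \<zeta> j" using breakpoints_le_iff[of i j] i j by auto
      then show "z \<le> x" using x i by auto
    qed
    then show "trunc_pow t x = poly (P j) x" using xab by (simp add: t trunc_pow_def poly_P)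
  next
    show "trunc_pow t b = poly (P (num_bp - 1)) b"
    proof -
      have "i \<in> {1..num_bp}" using i by auto
      then have "z \<le> b" using i breakpoints_range[of i] by auto
      then show ?thesis using i ab by (simp add: t trunc_pow_def poly_P)
    qed
  next
    fix j m assume j: "j \<in> {2..num_bp - 1}" and m: "m + kmult (\<zeta> j) \<le> p"
    show "poly ((pderiv ^^ m) (P (j - 1))) (\<zeta> j) = poly ((pderiv ^^ m) (P j)) (\<zeta> j)"
    proof (cases "j = i")
      case False
      then have "P (j - 1) = P j" by (auto simp: P_def)
      then show ?thesis by simp
    next
      case True
      have "pcompose ([:- z, 1:] ^ l) [:z, 1:] = ([:0, 1:] :: real poly) ^ l"
        by (intro poly_eq_poly_eq_iff[THEN iffD1] ext) (simp add: poly_pcompose poly_power)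
      then have "poly ((pderiv ^^ m) (P j)) z = 0"
        using True m zl i by (simp add: higher_pderiv_eq_taylor_coeff P_def coeff_linear_poly_power)
      moreover have "\<not> i \<le> j - 1" using True j by auto
      then have "P (j - 1) = 0" by (simp add: P_def)
      ultimately show ?thesis using True i by simp
    qed
  qed
qed

text \<open>
  A spline is the sum of its jumps: with \<open>D\<^sub>j\<close> the difference of consecutive polynomial pieces at \<open>\<zeta>\<^sub>j\<close>, it
  equals \<open>\<Sum>\<^sub>j [\<zeta>\<^sub>j \<le> x] D\<^sub>j(x)\<close>, and by smoothness the Taylor expansion of \<open>D\<^sub>j\<close> at \<open>\<zeta>\<^sub>j\<close> contains only the
  exponents admitted in \<open>trunc_index\<close>.
\<close>

lemma spline_space_in_span_trunc:
  assumes "g \<in> spline_space a b n p \<xi>"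
  shows "g \<in> fun_vs.span (trunc_pow ` trunc_index)"
proof -
  from assms obtain P where out: "\<And>x. x \<notin> {a..b} \<Longrightarrow> g x = 0"
    and deg: "\<And>j. j \<in> {1..num_bp - 1} \<Longrightarrow> degree (P j) \<le> p"
    and P: "\<And>j x. j \<in> {1..num_bp - 1} \<Longrightarrow> x \<in> {\<zeta> j..<\<zeta> (j + 1)} \<Longrightarrow> g x = poly (P j) x"
    and Pb: "g b = poly (P (num_bp - 1)) b"
    and smooth: "\<And>j l. j \<in> {2..num_bp - 1} \<Longrightarrow> l + kmult (\<zeta> j) \<le> p \<Longrightarrow>
       poly ((pderiv ^^ l) (P (j - 1))) (\<zeta> j) = poly ((pderiv ^^ l) (P j)) (\<zeta> j)"
    unfolding spline_space_def by blast
  \<comment> \<open>A zero piece to the left of \<open>a\<close> makes the whole first polynomial count as the jump at \<open>a\<close>.\<close>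
  define Q where "Q j = (if j = 0 then 0 else P j)" for j
  define D where "D j = Q j - Q (j - 1)" for j
  have degD: "degree (D j) \<le> p" if "j \<in> {1..num_bp - 1}" for j
  proof -
    have "degree (P (j - 1)) \<le> p" if "j \<noteq> 1" using that \<open>j \<in> {1..num_bp - 1}\<close> by (intro deg) auto
    then show ?thesis
      unfolding D_def Q_def using that deg[of j] by (intro degree_diff_le) auto
  qed
  let ?d = "\<lambda>j l. coeff (pcompose (D j) [:\<zeta> j, 1:]) l"
  have d0: "?d j l = 0" if j: "j \<in> {1..num_bp - 1}" and l: "l < p + 1 - kmult (\<zeta> j)" for j l
  proof (cases "j = 1")
    case True
    then show ?thesis using l breakpoint_first mult_a by simp
  next
    case False
    have "poly ((pderiv ^^ l) (D j)) (\<zeta> j) = 0"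
      using smooth[of j l] False j l
      by (simp add: D_def Q_def higher_pderiv_eq_taylor_coeff pcompose_diff)
    then show ?thesis by (simp add: higher_pderiv_eq_taylor_coeff)
  qed
  have D_eq: "poly (D j) x = (\<Sum>l = p + 1 - kmult (\<zeta> j)..p. ?d j l * (x - \<zeta> j) ^ l)"
    if j: "j \<in> {1..num_bp - 1}" for j x
    unfolding poly_eq_taylor_sum[OF degD[OF j], of x "\<zeta> j"]
    using d0[OF j] by (intro sum.mono_neutral_right) auto
  have D_trunc: "(if \<zeta> j \<le> x then poly (D j) x else 0) =
      (\<Sum>l = p + 1 - kmult (\<zeta> j)..p. ?d j l * trunc_pow (\<zeta> j, l) x)"
    if "j \<in> {1..num_bp - 1}" "x \<in> {a..b}" for j x
    using that by (simp add: trunc_pow_def D_eq)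
  have tele: "(\<Sum>j = 1..m. poly (D j) x) = poly (Q m) x" for m x
    by (induction m) (simp_all add: D_def Q_def)
  have g_eq: "g x = (\<Sum>j = 1..num_bp - 1. if \<zeta> j \<le> x then poly (D j) x else 0)" if x: "x \<in> {a..b}" for x
  proof (cases "x = b")
    case True
    have "(\<Sum>j = 1..num_bp - 1. if \<zeta> j \<le> x then poly (D j) x else 0) = (\<Sum>j = 1..num_bp - 1. poly (D j) x)"
      using True breakpoints_range by (intro sum.cong) auto
    then show ?thesis using True Pb tele two_breakpoints by (simp add: Q_def)
  next
    case False
    then obtain k where k: "k \<in> {1..num_bp - 1}" "x \<in> {\<zeta> k..<\<zeta> (k + 1)}"
      using locate_breakpoint_span[of x] x by auto
    have iff: "\<zeta> j \<le> x \<longleftrightarrow> j \<le> k" if j: "j \<in> {1..num_bp - 1}" for j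
    proof
      assume "\<zeta> j \<le> x"
      then have "\<not> \<zeta> (k + 1) \<le> \<zeta> j" using k by auto
      moreover have "k + 1 \<in> {1..num_bp}" "j \<in> {1..num_bp}" using j k by auto
      ultimately have "\<not> k + 1 \<le> j" using breakpoints_le_iff[of "k + 1" j] by blast
      then show "j \<le> k" by simp
    next
      assume "j \<le> k"
      then have "\<zeta> j \<le> \<zeta> k" using breakpoints_le_iff[of j k] j k by auto
      then show "\<zeta> j \<le> x" using k by auto
    qed
    have "(\<Sum>j = 1..num_bp - 1. if \<zeta> j \<le> x then poly (D j) x else 0) = 
        (\<Sum>j = 1..num_bp - 1. if j \<le> k then poly (D j) x else 0)"
      using iff by (intro sum.cong) auto
    also have "\<dots> = (\<Sum>j = 1..k. poly (D j) x)"
      using k by (intro sum.mono_neutral_cong_right) auto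
    finally show ?thesis using tele[where m = k] P[OF k] k by (simp add: Q_def)
  qed
  have "g = (\<Sum>j = 1..num_bp - 1. \<Sum>l = p + 1 - kmult (\<zeta> j)..p. (\<lambda>x. ?d j l * trunc_pow (\<zeta> j, l) x))"
  proof
    fix x
    show "g x = (\<Sum>j = 1..num_bp - 1. \<Sum>l = p + 1 - kmult (\<zeta> j)..p. (\<lambda>x. ?d j l * trunc_pow (\<zeta> j, l) x)) x"
      unfolding sum_fun_apply
    proof (cases "x \<in> {a..b}")
      case True
      show "g x = (\<Sum>j = 1..num_bp - 1. \<Sum>l = p + 1 - kmult (\<zeta> j)..p. ?d j l * trunc_pow (\<zeta> j, l) x)"
        unfolding g_eq[OF True] by (intro sum.cong D_trunc refl True)
    next
      case False
      then have "trunc_pow (z, l) x = 0" for z l by (auto simp: trunc_pow_def)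
      then show "g x = (\<Sum>j = 1..num_bp - 1. \<Sum>l = p + 1 - kmult (\<zeta> j)..p. ?d j l * trunc_pow (\<zeta> j, l) x)"
        using out[OF False] by simp
    qed
  qed
  also have "\<dots> \<in> fun_vs.span (trunc_pow ` trunc_index)"
  proof (intro fun_vs.span_sum fun_vs.span_scale fun_vs.span_base imageI)
    fix j l assume "j \<in> {1..num_bp - 1}" "l \<in> {p + 1 - kmult (\<zeta> j)..p}"
    then show "(\<zeta> j, l) \<in> trunc_index"
      using breakpoints_image_initial unfolding trunc_index_def by blast
  qed
  finally show ?thesis .
qed

lemma subspace_spline_space: "fun_vs.subspace (spline_space a b n p \<xi>)"
proof (rule fun_vs.subspaceI)
  show "0 \<in> spline_space a b n p \<xi>"
    unfolding spline_space_def by (auto intro!: exI[of _ "\<lambda>_. 0"])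
next
  fix g h assume "g \<in> spline_space a b n p \<xi>" "h \<in> spline_space a b n p \<xi>"
  then obtain P Q where gh: "\<forall>x. x \<notin> {a..b} \<longrightarrow> g x = 0" "\<forall>x. x \<notin> {a..b} \<longrightarrow> h x = 0"
    and P: "\<forall>j \<in> {1..num_bp - 1}. degree (P j) \<le> p \<and> (\<forall>x \<in> {\<zeta> j..<\<zeta> (j + 1)}. g x = poly (P j) x)"
      "g b = poly (P (num_bp - 1)) b"
      "\<forall>j \<in> {2..num_bp - 1}. \<forall>l. l + kmult (\<zeta> j) \<le> p \<longrightarrow>
         poly ((pderiv ^^ l) (P (j - 1))) (\<zeta> j) = poly ((pderiv ^^ l) (P j)) (\<zeta> j)"
    and Q: "\<forall>j \<in> {1..num_bp - 1}. degree (Q j) \<le> p \<and> (\<forall>x \<in> {\<zeta> j..<\<zeta> (j + 1)}. h x = poly (Q j) x)"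
      "h b = poly (Q (num_bp - 1)) b"
      "\<forall>j \<in> {2..num_bp - 1}. \<forall>l. l + kmult (\<zeta> j) \<le> p \<longrightarrow>
         poly ((pderiv ^^ l) (Q (j - 1))) (\<zeta> j) = poly ((pderiv ^^ l) (Q j)) (\<zeta> j)"
    unfolding spline_space_def by blast
  show "g + h \<in> spline_space a b n p \<xi>"
    unfolding spline_space_def mem_Collect_eq
    using gh P Q
    by (intro conjI exI[of _ "\<lambda>j. P j + Q j"])
      (simp_all add: degree_add_le higher_pderiv_eq_taylor_coeff pcompose_add)
next
  fix c g assume "g \<in> spline_space a b n p \<xi>"
  then obtain P where g: "\<forall>x. x \<notin> {a..b} \<longrightarrow> g x = 0"
    and P: "\<forall>j \<in> {1..num_bp - 1}. degree (P j) \<le> p \<and> (\<forall>x \<in> {\<zeta> j..<\<zeta> (j + 1)}. g x = poly (P j) x)"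
      "g b = poly (P (num_bp - 1)) b"
      "\<forall>j \<in> {2..num_bp - 1}. \<forall>l. l + kmult (\<zeta> j) \<le> p \<longrightarrow>
         poly ((pderiv ^^ l) (P (j - 1))) (\<zeta> j) = poly ((pderiv ^^ l) (P j)) (\<zeta> j)"
    unfolding spline_space_def by blast
  show "(\<lambda>x. c * g x) \<in> spline_space a b n p \<xi>"
    unfolding spline_space_def mem_Collect_eq
    using g P
    by (intro conjI exI[of _ "\<lambda>j. Polynomial.smult c (P j)"])
      (simp_all add: higher_pderiv_eq_taylor_coeff pcompose_smult)
qed

text \<open>
  The Curry--Schoenberg theorem, with \<open>B\<^sub>1\<close> replaced by \<open>1\<close>.
\<close>

theorem spline_space_eq_span: "spline_space a b n p \<xi> = fun_vs.span (restricted_aux ` {1..n})"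
  unfolding span_aux_eq_span_trunc
proof
  show "spline_space a b n p \<xi> \<subseteq> fun_vs.span (trunc_pow ` trunc_index)"
    using spline_space_in_span_trunc by blast
  show "fun_vs.span (trunc_pow ` trunc_index) \<subseteq> spline_space a b n p \<xi>"
    using trunc_pow_in_spline_space by (intro fun_vs.span_minimal subspace_spline_space) blast
qed

lemma spline_bounded_measurable:
  assumes "g \<in> spline_space a b n p \<xi>"
  shows "g \<in> borel_measurable borel" "\<exists>C. \<forall>x. \<bar>g x\<bar> \<le> C"
proof -
  obtain c where c: "\<And>x. g x = (\<Sum>j\<in>trunc_index. c j * trunc_pow j x)"
    using spline_space_in_span_trunc[OF assms] span_family_iff[OF finite_trunc_index] by blast
  have meas: "trunc_pow j \<in> borel_measurable borel" for j
    unfolding trunc_pow_def case_prod_beta by measurable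
  show "g \<in> borel_measurable borel"
  proof -
    have "g = (\<lambda>x. \<Sum>j\<in>trunc_index. c j * trunc_pow j x)" using c by blast
    then show ?thesis using meas by simp
  qed
  have bd: "\<bar>trunc_pow j x\<bar> \<le> (b - a) ^ snd j" if j: "j \<in> trunc_index" for j x
  proof -
    have "a \<le> fst j" using j knots_range by (fastforce simp: trunc_index_def)
    then show ?thesis using ab
      by (cases j) (auto simp: trunc_pow_def power_abs[symmetric] intro!: power_mono)
  qed
  show "\<exists>C. \<forall>x. \<bar>g x\<bar> \<le> C"
  proof (intro exI allI)
    fix x
    have "\<bar>g x\<bar> \<le> (\<Sum>j\<in>trunc_index. \<bar>c j * trunc_pow j x\<bar>)" unfolding c by (rule sum_abs)
    also have "\<dots> \<le> (\<Sum>j\<in>trunc_index. \<bar>c j\<bar> * (b - a) ^ snd j)"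
      by (intro sum_mono) (simp add: abs_mult bd mult_left_mono)
    finally show "\<bar>g x\<bar> \<le> (\<Sum>j\<in>trunc_index. \<bar>c j\<bar> * (b - a) ^ snd j)" .
  qed
qed

end

section \<open>Cholesky factors of positive definite matrices\<close>

text \<open>
  Induction by splitting off the first row and column: the Schur complement \<open>S\<close> is again positive
  definite, because its quadratic form at \<open>c\<close> is that of \<open>G\<close> at \<open>(-t/g, c)\<close>, the minimum over the first
  coordinate. The factor of \<open>S\<close> is bordered by the column \<open>G\<^bsub>i0\<^esub> / \<surd>g\<close>.
\<close>

lemma cholesky_factor_exists:
  fixes G :: "nat \<Rightarrow> nat \<Rightarrow> real"
  assumes "\<And>i j. i < n \<Longrightarrow> j < n \<Longrightarrow> G i j = G j i"
    and "\<And>c. \<exists>i<n. c i \<noteq> 0 \<Longrightarrow> 0 < (\<Sum>i<n. \<Sum>j<n. c i * c j * G i j)"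
  shows "\<exists>Q. (\<forall>i j. i < j \<longrightarrow> Q i j = 0) \<and> (\<forall>i<n. 0 < Q i i) \<and>
    (\<forall>i<n. \<forall>j<n. G i j = (\<Sum>k<n. Q i k * Q j k))"
  using assms
proof (induction n arbitrary: G)
  case 0
  show ?case by (intro exI[of _ "\<lambda>_ _. 0"]) simp
next
  case (Suc n)
  note sym = Suc.prems(1) and pd = Suc.prems(2)
  define g where "g = G 0 0"
  have "(\<Sum>i<Suc n. \<Sum>j<Suc n. (if i = 0 then 1 else 0) * (if j = 0 then 1 else 0) * G i j) = g"
    unfolding sum.lessThan_Suc_shift by (simp add: g_def)
  then have g: "g > 0" using pd[of "\<lambda>i. if i = 0 then 1 else 0"] by auto
  define S where "S i j = G (Suc i) (Suc j) - G (Suc i) 0 * G 0 (Suc j) / g" for i j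
  have S_sym: "S i j = S j i" if "i < n" "j < n" for i j
    using that sym[of "Suc i" "Suc j"] sym[of "Suc i" 0] sym[of "Suc j" 0] by (simp add: S_def)
  have S_pd: "0 < (\<Sum>i<n. \<Sum>j<n. c i * c j * S i j)" if nz: "\<exists>i<n. c i \<noteq> 0" for c
  proof -
    define t where "t = (\<Sum>j<n. c j * G 0 (Suc j))"
    have t': "(\<Sum>i<n. c i * G (Suc i) 0) = t"
      unfolding t_def using sym by (intro sum.cong) auto
    define e where "e = - t / g"
    define c' where "c' = case_nat e c"
    have "0 < (\<Sum>i<Suc n. \<Sum>j<Suc n. c' i * c' j * G i j)"
    proof (rule pd)
      from nz obtain i where "i < n" "c i \<noteq> 0" by blast
      then show "\<exists>i<Suc n. c' i \<noteq> 0" by (intro exI[of _ "Suc i"]) (simp add: c'_def)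
    qed
    also have "\<dots> = e * e * g + e * (\<Sum>j<n. c j * G 0 (Suc j)) +
        (e * (\<Sum>i<n. c i * G (Suc i) 0) + (\<Sum>i<n. \<Sum>j<n. c i * c j * G (Suc i) (Suc j)))"
      unfolding sum.lessThan_Suc_shift
      by (simp add: c'_def g_def sum.distrib sum_distrib_left mult_ac)
    also have "\<dots> = (\<Sum>i<n. \<Sum>j<n. c i * c j * G (Suc i) (Suc j)) - t * t / g"
      unfolding t' t_def[symmetric] e_def using g by (simp add: field_simps)
    also have "t * t / g = (\<Sum>i<n. \<Sum>j<n. c i * c j * (G (Suc i) 0 * G 0 (Suc j) / g))"
    proof -
      have "t * t = (\<Sum>i<n. \<Sum>j<n. (c i * G (Suc i) 0) * (c j * G 0 (Suc j)))"
        unfolding sum_product[symmetric] t' t_def[symmetric] ..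
      then show ?thesis by (simp add: sum_divide_distrib mult_ac)
    qed
    also have "(\<Sum>i<n. \<Sum>j<n. c i * c j * G (Suc i) (Suc j)) - \<dots> = (\<Sum>i<n. \<Sum>j<n. c i * c j * S i j)"
      by (simp add: S_def right_diff_distrib sum_subtractf)
    finally show ?thesis .
  qed
  obtain Q where Q: "\<And>i j. i < j \<Longrightarrow> Q i j = 0" "\<And>i. i < n \<Longrightarrow> 0 < Q i i"
      "\<And>i j. i < n \<Longrightarrow> j < n \<Longrightarrow> S i j = (\<Sum>k<n. Q i k * Q j k)"
    using Suc.IH[OF S_sym S_pd] by blast
  define P where "P i j = (case j of 0 \<Rightarrow> G i 0 / sqrt g
     | Suc j' \<Rightarrow> (case i of 0 \<Rightarrow> 0 | Suc i' \<Rightarrow> Q i' j'))" for i j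
  have "P i j = 0" if "i < j" for i j
    using that Q(1) by (auto simp: P_def split: nat.splits)
  moreover have "0 < P i i" if "i < Suc n" for i
    using that Q(2) g by (auto simp: P_def g_def[symmetric] split: nat.splits)
  moreover have "G i j = (\<Sum>k<Suc n. P i k * P j k)" if ij: "i < Suc n" "j < Suc n" for i j
  proof -
    have sum: "(\<Sum>k<Suc n. P i k * P j k) = G i 0 * G j 0 / g + (\<Sum>k<n. P i (Suc k) * P j (Suc k))"
      unfolding sum.lessThan_Suc_shift using g by (simp add: P_def)
    show ?thesis
    proof (cases i)
      case 0
      then show ?thesis
        using g sym[of 0 j] ij unfolding sum by (simp add: P_def g_def)
    next
      case i: (Suc i')
      show ?thesis
      proof (cases j)
        case 0
        then show ?thesis using g ij unfolding sum by (simp add: P_def g_def)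
      next
        case j: (Suc j')
        have "(\<Sum>k<n. P i (Suc k) * P j (Suc k)) = S i' j'"
          using Q(3)[of i' j'] ij i j by (simp add: P_def)
        then show ?thesis using sym[of "Suc j'" 0] ij unfolding sum by (simp add: S_def i j)
      qed
    qed
  qed
  ultimately show ?case by blast
qed

text \<open>
  Existence of a factor makes the choice in \<open>cholesky\<close> meaningful; the chosen factor is triangular with
  positive diagonal, hence invertible, and the last equation is \<open>Q\<inverse> (Q Q\<^sup>T) Q\<^sup>-\<^sup>T = 1\<close>.
\<close>

lemma cholesky_inverse:
  fixes g :: "nat \<Rightarrow> nat \<Rightarrow> real"
  assumes "\<And>i j. i < n \<Longrightarrow> j < n \<Longrightarrow> g i j = g j i"
    and "\<And>c. \<exists>i<n. c i \<noteq> 0 \<Longrightarrow> 0 < (\<Sum>i<n. \<Sum>j<n. c i * c j * g i j)"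
  defines "G \<equiv> mat n n (\<lambda>(i, j). g i j)"
  defines "R \<equiv> the (mat_inverse (cholesky G))"
  shows "R \<in> carrier_mat n n" "cholesky G \<in> carrier_mat n n" "cholesky G * R = 1\<^sub>m n"
    "R * G * transpose_mat R = 1\<^sub>m n"
proof -
  let ?P = "\<lambda>Q. Q \<in> carrier_mat (dim_row G) (dim_row G) \<and>
     upper_triangular (transpose_mat Q) \<and> (\<forall>i < dim_row G. 0 < Q $$ (i, i)) \<and> G = Q * transpose_mat Q"
  define Q where "Q = cholesky G"
  have dim: "dim_row G = n" "G \<in> carrier_mat n n" by (simp_all add: G_def)
  obtain F where F: "\<And>i j. i < j \<Longrightarrow> F i j = 0" "\<And>i. i < n \<Longrightarrow> 0 < F i i"
    "\<And>i j. i < n \<Longrightarrow> j < n \<Longrightarrow> g i j = (\<Sum>k<n. F i k * F j k)"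
    using cholesky_factor_exists[OF assms(1,2)] by blast
  have "?P (mat n n (\<lambda>(i, j). F i j))"
    unfolding dim
    by (auto simp: upper_triangular_def F G_def scalar_prod_def atLeast0LessThan intro!: eq_matI)
  then have "?P (SOME Q. ?P Q)" by (rule someI[of ?P])
  then have "?P Q" unfolding Q_def cholesky_def .
  then have Q: "Q \<in> carrier_mat n n" "upper_triangular (transpose_mat Q)"
      "\<And>i. i < n \<Longrightarrow> 0 < Q $$ (i, i)" "G = Q * transpose_mat Q"
    unfolding dim by blast+
  have "Determinant.det Q = prod_list (diag_mat Q)"
    using Q(1,2) by (intro det_lower_triangular[of n]) (auto simp: upper_triangular_def)
  also have "\<dots> \<noteq> 0"
    using Q(1) by (auto simp: prod_list_zero_iff diag_mat_def) (metis Q(3) less_irrefl)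
  finally have unit: "Q \<in> Units (ring_mat TYPE(real) n ())"
    using Q(1) by (intro det_non_zero_imp_unit)
  then obtain R' where "mat_inverse Q = Some R'"
    using mat_inverse(1)[OF Q(1)] by fastforce
  then have R': "mat_inverse Q = Some R"
    by (simp add: R_def Q_def)
  from mat_inverse(2)[OF Q(1) this]
  have R: "Q * R = 1\<^sub>m n" "R * Q = 1\<^sub>m n" "R \<in> carrier_mat n n" by auto
  have "R * G * transpose_mat R = (R * Q) * (transpose_mat Q * transpose_mat R)"
    unfolding Q(4) using Q(1) R(3) by (simp add: assoc_mult_mat[of _ n n _ n _ n])
  also have "transpose_mat Q * transpose_mat R = transpose_mat (R * Q)"
    using Q(1) R(3) by (simp add: transpose_mult)
  finally show "R * G * transpose_mat R = 1\<^sub>m n" by (simp add: R(2))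
  show "R \<in> carrier_mat n n" "cholesky G \<in> carrier_mat n n" "cholesky G * R = 1\<^sub>m n"
    using Q(1) R unfolding Q_def by auto
qed

section \<open>Orthonormal splines in one random variable\<close>

locale random_spline_input = knot_sequence a b n p \<xi> + prob_space M
  for a b n p \<xi> and M :: "'w measure" +
  fixes Z :: "'w \<Rightarrow> real" and f :: "real \<Rightarrow> real"
  assumes Z_range: "\<And>\<omega>. \<omega> \<in> space M \<Longrightarrow> Z \<omega> \<in> {a..b}"
    and density: "distributed M lborel Z (\<lambda>x. ennreal (f x))"
    and f_nonneg: "\<And>x. 0 \<le> f x"
    and f_cont: "continuous_on {a..b} f"
    and f_support: "closure {x. 0 < f x} = {a..b}"
begin

lemma Z_measurable [measurable]: "Z \<in> borel_measurable M"
  using distributed_measurable[OF density] by simp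

lemma spline_prod_integrable:
  assumes "g \<in> spline_space a b n p \<xi>" "h \<in> spline_space a b n p \<xi>"
  shows "integrable M (\<lambda>\<omega>. g (Z \<omega>) * h (Z \<omega>))"
proof -
  have [measurable]: "g \<in> borel_measurable borel" "h \<in> borel_measurable borel"
    using assms spline_bounded_measurable(1) by blast+
  obtain C D where "\<And>x. \<bar>g x\<bar> \<le> C" "\<And>x. \<bar>h x\<bar> \<le> D"
    using assms spline_bounded_measurable(2) by metis
  then have "norm (g (Z \<omega>) * h (Z \<omega>)) \<le> C * D" for \<omega>
    unfolding real_norm_def abs_mult by (intro mult_mono) (auto intro: order_trans[OF abs_ge_zero])
  then show ?thesis by (intro integrable_const_bound[of _ "C * D"]) auto
qed

text \<open>
  The density is positive at some point of the given interval and, by continuity, near it. There \<open>h\<close>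
  vanishes Lebesgue-almost everywhere, which a function with finitely many zeros cannot do.
\<close>

lemma infinite_zeros_of_zero_second_moment:
  assumes h: "h \<in> spline_space a b n p \<xi>" and z: "(LINT \<omega>|M. (h (Z \<omega>))\<^sup>2) = 0"
    and uv: "a \<le> u" "u < v" "v \<le> b"
  shows "infinite {x \<in> {u<..<v}. h x = 0}"
proof
  assume fin: "finite {x \<in> {u<..<v}. h x = 0}"
  have [measurable]: "h \<in> borel_measurable borel"
    using h spline_bounded_measurable(1) by blast
  have sq: "integrable M (\<lambda>\<omega>. (h (Z \<omega>))\<^sup>2)"
    using spline_prod_integrable[OF h h] by (simp add: power2_eq_square)
  have "integrable lborel (\<lambda>x. f x * (h x)\<^sup>2)"
    by (subst distributed_integrable[OF density]) (auto intro: f_nonneg sq)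
  moreover have "(LINT x|lborel. f x * (h x)\<^sup>2) = 0"
    by (subst distributed_integral[OF density]) (auto intro: f_nonneg z)
  ultimately have AE0: "AE x in lborel. f x * (h x)\<^sup>2 = 0"
    by (subst (asm) integral_nonneg_eq_0_iff_AE) (auto intro!: AE_I2 mult_nonneg_nonneg f_nonneg)
  have "(u + v) / 2 \<in> closure {x. 0 < f x}" using f_support uv by auto
  moreover have "open {u<..<v}" "(u + v) / 2 \<in> {u<..<v}" using uv by auto
  ultimately obtain x0 where x0: "x0 \<in> {u<..<v}" "0 < f x0"
    by (metis (mono_tags, lifting) closure_iff_nhds_not_empty disjoint_iff mem_Collect_eq order_refl)
  have "isCont f x0"
    using f_cont x0 uv by (intro continuous_on_interior[of "{a..b}"]) auto
  then have "\<forall>\<^sub>F x in at x0. 0 < f x"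
    using x0 by (intro order_tendstoD(1)[where y = "f x0"]) (auto simp: isCont_def)
  moreover have "\<forall>\<^sub>F x in at x0. x \<in> {u<..<v}"
    using x0(1) by (intro eventually_at_in_open') auto
  ultimately have "\<forall>\<^sub>F x in at x0. 0 < f x \<and> x \<in> {u<..<v}" by eventually_elim auto
  then obtain e where e: "e > 0" "\<And>x. x \<noteq> x0 \<Longrightarrow> dist x x0 < e \<Longrightarrow> 0 < f x \<and> x \<in> {u<..<v}"
    unfolding eventually_at by auto
  have pos: "0 < f x \<and> x \<in> {u<..<v}" if "x \<in> {x0 - e<..<x0 + e}" for x
    using e(2)[of x] that x0 by (cases "x = x0") (auto simp: dist_real_def)
  have "AE x in lborel. x \<notin> {x \<in> {u<..<v}. h x = 0}"
    using fin by (intro AE_not_in finite_imp_null_set_lborel)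
  with AE0 have "AE x in lborel. x \<notin> {x0 - e<..<x0 + e}"
  proof eventually_elim
    case (elim x)
    then show ?case using pos[of x] by auto
  qed
  then have "emeasure lborel {x0 - e<..<x0 + e} = 0"
    by (subst (asm) AE_iff_measurable[of "{x0 - e<..<x0 + e}"]) (auto simp: set_eq_iff)
  then show False using e(1) by simp
qed

definition gram :: "nat \<Rightarrow> nat \<Rightarrow> real" where
  "gram i j = (LINT \<omega>|M. restricted_aux (i + 1) (Z \<omega>) * restricted_aux (j + 1) (Z \<omega>))"

lemma aux_in_spline_space: "i < n \<Longrightarrow> restricted_aux (i + 1) \<in> spline_space a b n p \<xi>"
  unfolding spline_space_eq_span by (intro fun_vs.span_base) auto

text \<open>
  Stated as a bilinear form since orthonormality needs two different coefficient vectors.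
\<close>

lemma gram_quadratic_form:
  "(\<Sum>i<n. \<Sum>j<n. c i * d j * gram i j) =
   (LINT \<omega>|M. (\<Sum>i<n. c i * restricted_aux (i + 1) (Z \<omega>)) * (\<Sum>j<n. d j * restricted_aux (j + 1) (Z \<omega>)))"
proof -
  let ?A = "\<lambda>i \<omega>. restricted_aux (i + 1) (Z \<omega>)"
  have int: "integrable M (\<lambda>\<omega>. c i * d j * (?A i \<omega> * ?A j \<omega>))" if "i < n" "j < n" for i j
    using that by (intro integrable_mult_right spline_prod_integrable aux_in_spline_space)
  have "(\<Sum>i<n. c i * ?A i \<omega>) * (\<Sum>j<n. d j * ?A j \<omega>) =
      (\<Sum>i<n. \<Sum>j<n. c i * d j * (?A i \<omega> * ?A j \<omega>))" for \<omega>
    unfolding sum_product by (intro sum.cong refl) simp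
  then have "(LINT \<omega>|M. (\<Sum>i<n. c i * ?A i \<omega>) * (\<Sum>j<n. d j * ?A j \<omega>)) =
      (LINT \<omega>|M. (\<Sum>i<n. \<Sum>j<n. c i * d j * (?A i \<omega> * ?A j \<omega>)))"
    by (simp only:)
  also have "\<dots> = (\<Sum>i<n. LINT \<omega>|M. (\<Sum>j<n. c i * d j * (?A i \<omega> * ?A j \<omega>)))"
    using int by (intro Bochner_Integration.integral_sum Bochner_Integration.integrable_sum) auto
  also have "\<dots> = (\<Sum>i<n. \<Sum>j<n. LINT \<omega>|M. c i * d j * (?A i \<omega> * ?A j \<omega>))"
    using int by (intro sum.cong refl Bochner_Integration.integral_sum) auto
  also have "\<dots> = (\<Sum>i<n. \<Sum>j<n. c i * d j * gram i j)"
    by (simp add: gram_def)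
  finally show ?thesis ..
qed

lemma gram_positive_definite:
  assumes "\<exists>i<n. c i \<noteq> 0"
  shows "0 < (\<Sum>i<n. \<Sum>j<n. c i * c j * gram i j)"
proof -
  define h where "h x = (\<Sum>i = 1..n. c (i - 1) * restricted_aux i x)" for x
  have h_eq: "(\<Sum>i<n. c i * restricted_aux (i + 1) x) = h x" for x
    unfolding h_def image_Suc_lessThan[symmetric] by (subst sum.reindex) auto
  have h: "h \<in> spline_space a b n p \<xi>"
    unfolding spline_space_eq_span
    by (subst span_family_iff) (auto simp: h_def intro!: exI[of _ "\<lambda>i. c (i - 1)"])
  have eq: "(\<Sum>i<n. \<Sum>j<n. c i * c j * gram i j) = (LINT \<omega>|M. (h (Z \<omega>))\<^sup>2)"
    unfolding gram_quadratic_form h_eq by (simp add: power2_eq_square)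
  have "(LINT \<omega>|M. (h (Z \<omega>))\<^sup>2) \<noteq> 0"
  proof
    assume "(LINT \<omega>|M. (h (Z \<omega>))\<^sup>2) = 0"
    then have "\<forall>i\<in>{1..n}. c (i - 1) = 0"
      using infinite_zeros_of_zero_second_moment[OF h] unfolding h_def by (intro restricted_aux_independent)
    then show False using assms by force
  qed
  moreover have "0 \<le> (LINT \<omega>|M. (h (Z \<omega>))\<^sup>2)" by simp
  ultimately show ?thesis unfolding eq by linarith
qed

lemma gram_sym: "gram i j = gram j i"
  by (simp add: gram_def mult.commute)

lemma gram_mat_eq: "gram_mat M Z b n p \<xi> = mat n n (\<lambda>(i, j). gram i j)"
  unfolding gram_mat_def gram_def
  by (intro cong_mat refl) (auto simp: restricted_aux_def intro!: Bochner_Integration.integral_cong dest: Z_range)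

definition restricted_orth :: "nat \<Rightarrow> real \<Rightarrow> real" where
  "restricted_orth i x = (if x \<in> {a..b} then orth_bspline M Z b n p \<xi> i x else 0)"

definition "chol = cholesky (gram_mat M Z b n p \<xi>)"
definition "chol_inv = the (mat_inverse chol)"

lemma cholesky_gram_inverse:
  "chol_inv \<in> carrier_mat n n" "chol \<in> carrier_mat n n" "chol * chol_inv = 1\<^sub>m n"
  "chol_inv * gram_mat M Z b n p \<xi> * transpose_mat chol_inv = 1\<^sub>m n"
  unfolding chol_inv_def chol_def gram_mat_eq
  by (rule cholesky_inverse, rule gram_sym, erule gram_positive_definite)+

lemma restricted_orth_eq:
  assumes "i \<in> {1..n}"
  shows "restricted_orth i x = (\<Sum>j<n. chol_inv $$ (i - 1, j) * restricted_aux (j + 1) x)"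
  using assms cholesky_gram_inverse(1)
  by (auto simp: restricted_orth_def orth_bspline_def restricted_aux_def scalar_prod_def
      chol_inv_def[symmetric] chol_def[symmetric] atLeast0LessThan)

lemma orth_in_spline_space:
  assumes "i \<in> {1..n}"
  shows "restricted_orth i \<in> spline_space a b n p \<xi>"
proof -
  have "restricted_orth i = (\<Sum>j<n. (\<lambda>x. chol_inv $$ (i - 1, j) * restricted_aux (j + 1) x))"
    by (rule ext) (simp only: sum_fun_apply restricted_orth_eq[OF assms])
  then show ?thesis
    by (simp only:) (intro fun_vs.subspace_sum fun_vs.subspace_scale subspace_spline_space
       aux_in_spline_space, simp)
qed

lemma orth_orthonormal:
  assumes "i \<in> {1..n}" "j \<in> {1..n}"
  shows "(LINT \<omega>|M. restricted_orth i (Z \<omega>) * restricted_orth j (Z \<omega>)) = (if i = j then 1 else 0)"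
proof -
  let ?R = "chol_inv" and ?G = "mat n n (\<lambda>(i, j). gram i j)"
  have ij: "i - 1 < n" "j - 1 < n" using assms by auto
  have "(LINT \<omega>|M. restricted_orth i (Z \<omega>) * restricted_orth j (Z \<omega>)) =
    (\<Sum>k<n. \<Sum>l<n. ?R $$ (i - 1, k) * ?R $$ (j - 1, l) * gram k l)"
    unfolding restricted_orth_eq[OF assms(1)] restricted_orth_eq[OF assms(2)]
    by (rule gram_quadratic_form[symmetric])
  also have "\<dots> = (\<Sum>l<n. (\<Sum>k<n. ?R $$ (i - 1, k) * gram k l) * ?R $$ (j - 1, l))"
    unfolding sum_distrib_right by (subst sum.swap) (simp add: mult_ac)
  also have "\<dots> = (?R * ?G * transpose_mat ?R) $$ (i - 1, j - 1)"
    using ij cholesky_gram_inverse(1) by (simp add: scalar_prod_def atLeast0LessThan)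
  also have "\<dots> = (if i = j then 1 else 0)"
    unfolding gram_mat_eq[symmetric] cholesky_gram_inverse(4) using ij assms by auto
  finally show ?thesis .
qed

text \<open>
  The relation \<open>P = Q \<psi>\<close> recovers \<open>1, B\<^sub>2, \<dots>, B\<^sub>n\<close> from the orthonormal splines.
\<close>

lemma spline_space_span_orth:
  assumes "g \<in> spline_space a b n p \<xi>"
  shows "\<exists>c. \<forall>x. g x = (\<Sum>i = 1..n. c i * restricted_orth i x)"
proof -
  have "restricted_aux (i + 1) \<in> fun_vs.span (restricted_orth ` {1..n})" if i: "i < n" for i
  proof -
    have "restricted_aux (i + 1) x = (\<Sum>j<n. chol $$ (i, j) * restricted_orth (j + 1) x)" for x
    proof -
      have "(\<Sum>j<n. chol $$ (i, j) * restricted_orth (j + 1) x) =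
          (\<Sum>j<n. \<Sum>k<n. chol $$ (i, j) * (chol_inv $$ (j, k) * restricted_aux (k + 1) x))"
        by (simp add: restricted_orth_eq sum_distrib_left)
      also have "\<dots> = (\<Sum>k<n. (\<Sum>j<n. chol $$ (i, j) * chol_inv $$ (j, k)) * restricted_aux (k + 1) x)"
        unfolding sum_distrib_right by (subst sum.swap) (simp add: mult_ac)
      also have "\<dots> = (\<Sum>k<n. (chol * chol_inv) $$ (i, k) * restricted_aux (k + 1) x)"
        using i cholesky_gram_inverse(1,2) by (intro sum.cong) (auto simp: scalar_prod_def atLeast0LessThan)
      also have "\<dots> = (\<Sum>k<n. (if k = i then 1 else 0) * restricted_aux (k + 1) x)"
        unfolding cholesky_gram_inverse(3) using i by (intro sum.cong) auto
      also have "\<dots> = restricted_aux (i + 1) x"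
        using i by (simp add: if_distrib[of "\<lambda>t. t * _"] cong: if_cong)
      finally show ?thesis ..
    qed
    then have "restricted_aux (i + 1) = (\<Sum>j<n. (\<lambda>x. chol $$ (i, j) * restricted_orth (j + 1) x))"
      by (intro ext) (simp only: sum_fun_apply)
    also have "\<dots> \<in> fun_vs.span (restricted_orth ` {1..n})"
      by (intro fun_vs.span_sum fun_vs.span_scale fun_vs.span_base) auto
    finally show ?thesis .
  qed
  then have "restricted_aux ` {1..n} \<subseteq> fun_vs.span (restricted_orth ` {1..n})"
    unfolding image_Suc_lessThan[symmetric] by auto
  then have "fun_vs.span (restricted_aux ` {1..n}) \<subseteq> fun_vs.span (restricted_orth ` {1..n})"
    by (intro fun_vs.span_minimal fun_vs.subspace_span)
  with assms have "g \<in> fun_vs.span (restricted_orth ` {1..n})"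
    unfolding spline_space_eq_span by blast
  then show ?thesis by (subst (asm) span_family_iff) auto
qed

end

section \<open>Expansion in a finite orthonormal family\<close>

text \<open>
  Pythagoras for coefficients that need not be the Fourier coefficients: completing the square shows the
  excess error \<open>\<Sum> (d\<^sub>i - C\<^sub>i)\<^sup>2\<close>.
\<close>

lemma orthonormal_expansion_error:
  fixes e :: "'i \<Rightarrow> 'w \<Rightarrow> real"
  assumes I: "finite I"
    and ee: "\<And>i j. i \<in> I \<Longrightarrow> j \<in> I \<Longrightarrow> integrable M (\<lambda>w. e i w * e j w)"
    and on: "\<And>i j. i \<in> I \<Longrightarrow> j \<in> I \<Longrightarrow> (LINT w|M. e i w * e j w) = (if i = j then 1 else 0)"
    and yy: "integrable M (\<lambda>w. (y w)\<^sup>2)"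
    and ye: "\<And>i. i \<in> I \<Longrightarrow> integrable M (\<lambda>w. y w * e i w)"
  shows "integrable M (\<lambda>w. (y w - (\<Sum>i\<in>I. d i * e i w))\<^sup>2)" (is ?int)
    and "(LINT w|M. (y w - (\<Sum>i\<in>I. d i * e i w))\<^sup>2) =
      (LINT w|M. (y w)\<^sup>2) - (\<Sum>i\<in>I. (LINT w|M. y w * e i w)\<^sup>2) +
      (\<Sum>i\<in>I. (d i - (LINT w|M. y w * e i w))\<^sup>2)" (is ?eq)
proof -
  have expand: "(y w - (\<Sum>i\<in>I. d i * e i w))\<^sup>2 = (y w)\<^sup>2 - (\<Sum>i\<in>I. 2 * d i * (y w * e i w)) +
      (\<Sum>i\<in>I. \<Sum>j\<in>I. d i * d j * (e i w * e j w))" for w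
  proof -
    have "(\<Sum>i\<in>I. 2 * d i * (y w * e i w)) = 2 * y w * (\<Sum>i\<in>I. d i * e i w)"
      by (simp add: sum_distrib_left mult_ac)
    moreover have "(\<Sum>i\<in>I. \<Sum>j\<in>I. d i * d j * (e i w * e j w)) = (\<Sum>i\<in>I. d i * e i w) * (\<Sum>i\<in>I. d i * e i w)"
      unfolding sum_product by (intro sum.cong refl) simp
    moreover have "(u - v)\<^sup>2 = u\<^sup>2 - 2 * u * v + v * v" for u v :: real
      by (simp add: power2_eq_square algebra_simps)
    ultimately show ?thesis by (simp only:)
  qed
  have int1: "integrable M (\<lambda>w. \<Sum>i\<in>I. 2 * d i * (y w * e i w))"
    by (intro Bochner_Integration.integrable_sum integrable_mult_right ye)
  have int2: "integrable M (\<lambda>w. \<Sum>j\<in>I. d i * d j * (e i w * e j w))" if "i \<in> I" for i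
    by (intro Bochner_Integration.integrable_sum integrable_mult_right ee that)
  have int3: "integrable M (\<lambda>w. \<Sum>i\<in>I. \<Sum>j\<in>I. d i * d j * (e i w * e j w))"
    by (intro Bochner_Integration.integrable_sum int2)
  show ?int unfolding expand using yy int1 int3 by auto
  have "(LINT w|M. (y w - (\<Sum>i\<in>I. d i * e i w))\<^sup>2) = (LINT w|M. (y w)\<^sup>2)
      - (LINT w|M. (\<Sum>i\<in>I. 2 * d i * (y w * e i w)))
      + (LINT w|M. (\<Sum>i\<in>I. \<Sum>j\<in>I. d i * d j * (e i w * e j w)))"
    unfolding expand using yy int1 int3
    by (subst Bochner_Integration.integral_add Bochner_Integration.integral_diff; simp)+
  also have "(LINT w|M. (\<Sum>i\<in>I. 2 * d i * (y w * e i w))) = (\<Sum>i\<in>I. 2 * d i * (LINT w|M. y w * e i w))"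
    using ye by (subst Bochner_Integration.integral_sum) auto
  also have "(LINT w|M. (\<Sum>i\<in>I. \<Sum>j\<in>I. d i * d j * (e i w * e j w))) =
      (\<Sum>i\<in>I. LINT w|M. (\<Sum>j\<in>I. d i * d j * (e i w * e j w)))"
    using int2 by (rule Bochner_Integration.integral_sum)
  also have "\<dots> = (\<Sum>i\<in>I. \<Sum>j\<in>I. LINT w|M. d i * d j * (e i w * e j w))"
    using ee by (intro sum.cong refl Bochner_Integration.integral_sum) auto
  also have "\<dots> = (\<Sum>i\<in>I. \<Sum>j\<in>I. d i * d j * (if i = j then 1 else 0))"
    by (intro sum.cong refl) (simp add: on)
  also have "\<dots> = (\<Sum>i\<in>I. (d i)\<^sup>2)"
    using I by (intro sum.cong refl) (simp add: power2_eq_square if_distrib cong: if_cong)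
  finally show ?eq
    by (simp add: power2_diff sum.distrib sum_subtractf mult_ac)
qed

section \<open>Tensor-product splines in independent random variables\<close>

locale random_spline_vector = prob_space M for M :: "'w measure" +
  fixes X :: "'w \<Rightarrow> real ^ ('n::finite)"
    and a b :: "real ^ 'n"
    and f :: "'n \<Rightarrow> real \<Rightarrow> real"
    and n p :: "'n \<Rightarrow> nat"
    and \<xi> :: "'n \<Rightarrow> nat \<Rightarrow> real"
  assumes ab: "\<And>k. a $ k < b $ k"
    and X_meas: "X \<in> measurable M (restrict_space borel (cbox a b))"
    and indep: "indep_vars (\<lambda>_. borel) (\<lambda>k \<omega>. X \<omega> $ k) UNIV"
    and density: "\<And>k. distributed M lborel (\<lambda>\<omega>. X \<omega> $ k) (\<lambda>x. ennreal (f k x))"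
    and f_nonneg: "\<And>k x. 0 \<le> f k x"
    and f_cont: "\<And>k. continuous_on {a $ k..b $ k} (f k)"
    and f_support: "\<And>k. closure {x. 0 < f k x} = {a $ k..b $ k}"
    and knots: "\<And>k. open_knot_seq (a $ k) (b $ k) (n k) (p k) (\<xi> k)"
begin

lemma X_in_box: "\<omega> \<in> space M \<Longrightarrow> X \<omega> \<in> cbox a b"
  using measurable_space[OF X_meas, of \<omega>] by (simp add: space_restrict_space)

lemma X_borel [measurable]: "X \<in> borel_measurable M"
  using X_meas by (simp add: measurable_restrict_space2_iff)

lemma vec_nth_borel [measurable]: "(\<lambda>x :: real ^ 'n. x $ k) \<in> borel_measurable borel"
  by (intro borel_measurable_continuous_onI continuous_intros)

lemma f_borel [measurable]: "f k \<in> borel_measurable borel"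
  using distributed_real_measurable[OF _ density, of k] f_nonneg by simp

lemma in_box_iff: "x \<in> cbox a b \<longleftrightarrow> (\<forall>k. x $ k \<in> {a $ k..b $ k})"
  by (simp add: mem_box_cart)

lemma marginal:
  "random_spline_input (a $ k) (b $ k) (n k) (p k) (\<xi> k) M (\<lambda>\<omega>. X \<omega> $ k) (f k)"
proof (unfold_locales)
  show "a $ k < b $ k" by (rule ab)
  show "open_knot_seq (a $ k) (b $ k) (n k) (p k) (\<xi> k)" by (rule knots)
  show "X \<omega> $ k \<in> {a $ k..b $ k}" if "\<omega> \<in> space M" for \<omega>
    using X_in_box[OF that] in_box_iff by blast
  show "distributed M lborel (\<lambda>\<omega>. X \<omega> $ k) (\<lambda>x. ennreal (f k x))" by (rule density)
  show "0 \<le> f k x" for x by (rule f_nonneg)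
  show "continuous_on {a $ k..b $ k} (f k)" by (rule f_cont)
  show "closure {x. 0 < f k x} = {a $ k..b $ k}" by (rule f_support)
qed

lemma marginal_knots: "knot_sequence (a $ k) (b $ k) (n k) (p k) (\<xi> k)"
  by unfold_locales (rule ab, rule knots)

abbreviation "S k \<equiv> spline_space (a $ k) (b $ k) (n k) (p k) (\<xi> k)"
abbreviation "\<psi> k \<equiv> random_spline_input.restricted_orth (a $ k) (b $ k) (n k) (p k) (\<xi> k) M (\<lambda>\<omega>. X \<omega> $ k)"

text \<open>
  Independence factorises the expectation. Membership in the spline spaces provides measurability and
  boundedness of the factors.
\<close>

lemma tensor_product_integral:
  assumes "\<And>k. g k \<in> S k" "\<And>k. h k \<in> S k"
  shows "integrable M (\<lambda>\<omega>. (\<Prod>k\<in>UNIV. g k (X \<omega> $ k)) * (\<Prod>k\<in>UNIV. h k (X \<omega> $ k)))"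
    and "(LINT \<omega>|M. (\<Prod>k\<in>UNIV. g k (X \<omega> $ k)) * (\<Prod>k\<in>UNIV. h k (X \<omega> $ k))) =
      (\<Prod>k\<in>UNIV. LINT \<omega>|M. g k (X \<omega> $ k) * h k (X \<omega> $ k))"
proof -
  have [measurable]: "g k \<in> borel_measurable borel" "h k \<in> borel_measurable borel" for k
    using knot_sequence.spline_bounded_measurable(1)[OF marginal_knots] assms by blast+
  have ind: "indep_vars (\<lambda>_. borel) (\<lambda>k \<omega>. g k (X \<omega> $ k) * h k (X \<omega> $ k)) UNIV"
    by (rule indep_vars_compose2[OF indep, of "\<lambda>k x. g k x * h k x"]) measurable
  have int: "integrable M (\<lambda>\<omega>. g k (X \<omega> $ k) * h k (X \<omega> $ k))" for k
    by (rule random_spline_input.spline_prod_integrable[OF marginal assms])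
  show "integrable M (\<lambda>\<omega>. (\<Prod>k\<in>UNIV. g k (X \<omega> $ k)) * (\<Prod>k\<in>UNIV. h k (X \<omega> $ k)))"
    unfolding prod.distrib[symmetric] by (rule indep_vars_integrable[OF _ ind int]) simp
  show "(LINT \<omega>|M. (\<Prod>k\<in>UNIV. g k (X \<omega> $ k)) * (\<Prod>k\<in>UNIV. h k (X \<omega> $ k))) =
      (\<Prod>k\<in>UNIV. LINT \<omega>|M. g k (X \<omega> $ k) * h k (X \<omega> $ k))"
    unfolding prod.distrib[symmetric] by (rule indep_vars_lebesgue_integral[OF _ ind int]) simp
qed

text \<open>
  The orthonormal multivariate splines extended by zero outside the box: in this form they belong to the
  tensor-product space, and they agree with \<open>orth_mbspline\<close> wherever \<open>X\<close> takes values.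
\<close>

definition \<Psi> :: "('n \<Rightarrow> nat) \<Rightarrow> real ^ 'n \<Rightarrow> real" where
  "\<Psi> i x = (\<Prod>k\<in>UNIV. \<psi> k (i k) (x $ k))"

lemma \<Psi>_eq: "x \<in> cbox a b \<Longrightarrow> \<Psi> i x = orth_mbspline M X b n p \<xi> i x"
  unfolding \<Psi>_def orth_mbspline_def in_box_iff
  by (intro prod.cong refl) (simp add: random_spline_input.restricted_orth_def[OF marginal])

lemma multi_indices_eq: "multi_indices n = PiE UNIV (\<lambda>k. {1..n k})"
  by (auto simp: multi_indices_def PiE_UNIV_domain)

lemma finite_multi_indices: "finite (multi_indices n)"
  unfolding multi_indices_eq by (intro finite_PiE) auto

lemma \<psi>_in_S: "i \<in> multi_indices n \<Longrightarrow> \<psi> k (i k) \<in> S k"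
  by (intro random_spline_input.orth_in_spline_space[OF marginal]) (auto simp: multi_indices_def)

lemma \<Psi>_orthonormal:
  assumes "i \<in> multi_indices n" "j \<in> multi_indices n"
  shows "integrable M (\<lambda>\<omega>. \<Psi> i (X \<omega>) * \<Psi> j (X \<omega>))"
    and "(LINT \<omega>|M. \<Psi> i (X \<omega>) * \<Psi> j (X \<omega>)) = (if i = j then 1 else 0)"
proof -
  show "integrable M (\<lambda>\<omega>. \<Psi> i (X \<omega>) * \<Psi> j (X \<omega>))"
    unfolding \<Psi>_def using assms by (intro tensor_product_integral \<psi>_in_S)
  have "(LINT \<omega>|M. \<Psi> i (X \<omega>) * \<Psi> j (X \<omega>)) =
      (\<Prod>k\<in>UNIV. LINT \<omega>|M. \<psi> k (i k) (X \<omega> $ k) * \<psi> k (j k) (X \<omega> $ k))"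
    unfolding \<Psi>_def using assms by (intro tensor_product_integral \<psi>_in_S)
  also have "\<dots> = (\<Prod>k\<in>UNIV. if i k = j k then 1 else 0)"
    using assms by (intro prod.cong refl random_spline_input.orth_orthonormal[OF marginal])
      (auto simp: multi_indices_def)
  also have "\<dots> = (if i = j then 1 else 0)"
    by (cases "i = j") (auto simp: fun_eq_iff)
  finally show "(LINT \<omega>|M. \<Psi> i (X \<omega>) * \<Psi> j (X \<omega>)) = (if i = j then 1 else 0)" .
qed

lemma \<Psi>_borel: "i \<in> multi_indices n \<Longrightarrow> \<Psi> i \<in> borel_measurable borel"
proof -
  assume i: "i \<in> multi_indices n"
  have [measurable]: "\<psi> k (i k) \<in> borel_measurable borel" for k
    using knot_sequence.spline_bounded_measurable(1)[OF marginal_knots \<psi>_in_S[OF i]] .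
  show ?thesis unfolding \<Psi>_def by measurable
qed

text \<open>
  Expanding each factor of a product \<open>\<Prod>\<^sub>k g\<^sub>k\<close> in the orthonormal splines of its coordinate and
  distributing the product over the sums yields a combination of the \<open>\<Psi>\<^sub>i\<close>.
\<close>

lemma tensor_spline_space_eq:
  "tensor_spline_space a b n p \<xi> = range (\<lambda>d x. \<Sum>i\<in>multi_indices n. d i * \<Psi> i x)"
proof (intro equalityI subsetI)
  fix g assume "g \<in> tensor_spline_space a b n p \<xi>"
  then show "g \<in> range (\<lambda>d x. \<Sum>i\<in>multi_indices n. d i * \<Psi> i x)"
    unfolding tensor_spline_space_def
  proof (induction rule: fun_vs.span_induct_alt)
    case base
    show ?case by (rule image_eqI[of _ _ "\<lambda>_. 0"]) auto
  next
    case (step c u w)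
    then obtain h d where h: "\<And>k. h k \<in> S k" "u = (\<lambda>x. \<Prod>k\<in>UNIV. h k (x $ k))"
      and d: "w = (\<lambda>x. \<Sum>i\<in>multi_indices n. d i * \<Psi> i x)" by blast
    obtain e where e: "\<And>k x. h k x = (\<Sum>i = 1..n k. e k i * \<psi> k i x)"
      using random_spline_input.spline_space_span_orth[OF marginal h(1)] by metis
    have u: "u x = (\<Sum>i\<in>multi_indices n. (\<Prod>k\<in>UNIV. e k (i k)) * \<Psi> i x)" for x
      unfolding h(2) e multi_indices_eq \<Psi>_def prod.distrib[symmetric]
      by (rule prod_sum_PiE) auto
    show ?case
      by (rule image_eqI[of _ _ "\<lambda>i. c * (\<Prod>k\<in>UNIV. e k (i k)) + d i"])
        (auto simp: fun_eq_iff u d distrib_right sum.distrib sum_distrib_left mult.assoc)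
  qed
next
  fix g assume "g \<in> range (\<lambda>d x. \<Sum>i\<in>multi_indices n. d i * \<Psi> i x)"
  then obtain d where "g = (\<Sum>i\<in>multi_indices n. (\<lambda>x. d i * \<Psi> i x))"
    by (auto simp: fun_eq_iff sum_fun_apply)
  also have "\<dots> \<in> tensor_spline_space a b n p \<xi>"
    unfolding tensor_spline_space_def
  proof (intro fun_vs.span_sum fun_vs.span_scale fun_vs.span_base CollectI)
    fix i assume "i \<in> multi_indices n"
    then show "\<exists>g. \<Psi> i = (\<lambda>x. \<Prod>k\<in>UNIV. g k (x $ k)) \<and> (\<forall>k. g k \<in> S k)"
      by (intro exI[of _ "\<lambda>k. \<psi> k (i k)"]) (auto simp: \<Psi>_def \<psi>_in_S)
  qed
  finally show "g \<in> tensor_spline_space a b n p \<xi>" .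
qed

lemma joint_density_borel [measurable]: "joint_density f \<in> borel_measurable borel"
  unfolding joint_density_def by measurable

lemma joint_density_nonneg: "0 \<le> joint_density f x"
  unfolding joint_density_def by (intro prod_nonneg) (simp add: f_nonneg)

text \<open>
  Both measures factorise on open boxes, which generate the Borel sets and are stable under
  intersection: the law of \<open>X\<close> by independence, the density by Fubini.
\<close>

lemma distr_X_eq_density: "distr M borel X = density lborel (\<lambda>x. ennreal (joint_density f x))"
proof (rule measure_eqI_generator_eq)
  let ?E = "range (\<lambda>(l, u). box l u :: (real ^ 'n) set)"
  let ?A = "\<lambda>i::nat. box (- (real i *\<^sub>R One)) (real i *\<^sub>R One) :: (real ^ 'n) set"
  show "Int_stable ?E" by (auto simp: Int_stable_def box_Int_box)
  show "?E \<subseteq> Pow UNIV" "sets (distr M borel X) = sigma_sets UNIV ?E"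
    "sets (density lborel (\<lambda>x. ennreal (joint_density f x))) = sigma_sets UNIV ?E"
    by (simp_all add: borel_eq_box)
  show "range ?A \<subseteq> ?E" "(\<Union>i. ?A i) = UNIV" unfolding UN_box_eq_UNIV by auto
  show "emeasure (distr M borel X) (?A i) \<noteq> \<infinity>" for i
    by (simp add: emeasure_distr)
  fix B assume "B \<in> ?E"
  then obtain l u where B: "B = box l u" by auto
  let ?I = "\<lambda>k. {l $ k<..<u $ k}"
  have box: "x \<in> box l u \<longleftrightarrow> (\<forall>k. x $ k \<in> ?I k)" for x
    by (simp add: mem_box_cart)
  have "emeasure (distr M borel X) B = emeasure M (\<Inter>k\<in>UNIV. (\<lambda>\<omega>. X \<omega> $ k) -` ?I k \<inter> space M)"
    unfolding B by (subst emeasure_distr) (auto simp: box intro!: arg_cong[where f = "emeasure M"])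
  also have "\<dots> = (\<Prod>k\<in>UNIV. emeasure M ((\<lambda>\<omega>. X \<omega> $ k) -` ?I k \<inter> space M))"
    using indep_varsD_finite[OF indep, of ?I]
    by (simp add: emeasure_eq_measure prod_ennreal measure_nonneg)
  also have "\<dots> = (\<Prod>k\<in>UNIV. \<integral>\<^sup>+x. ennreal (f k x) * indicator (?I k) x \<partial>lborel)"
    by (intro prod.cong refl distributed_emeasure[OF density]) simp
  also have "\<dots> = (\<Prod>v\<in>(Basis :: (real ^ 'n) set). \<integral>\<^sup>+x. ennreal (f (axis_index v) x) * indicator (?I (axis_index v)) x \<partial>lborel)"
  proof -
    have inj: "inj (\<lambda>k::'n. axis k (1::real))" by (auto simp: inj_def axis_eq_axis)
    have Bas: "(Basis :: (real ^ 'n) set) = range (\<lambda>k. axis k 1)" by (auto simp: Basis_vec_def)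
    show ?thesis by (simp add: Bas prod.reindex[OF inj] axis_index_axis)
  qed
  also have "\<dots> = (\<integral>\<^sup>+x. (\<Prod>v\<in>(Basis :: (real ^ 'n) set). ennreal (f (axis_index v) (x \<bullet> v)) * indicator (?I (axis_index v)) (x \<bullet> v)) \<partial>lborel)"
    by (rule nn_integral_lborel_prod[symmetric]) (auto intro!: borel_measurable_times_ennreal)
  also have "\<dots> = (\<integral>\<^sup>+x. ennreal (joint_density f x) * indicator B x \<partial>lborel)"
  proof (intro nn_integral_cong)
    fix x :: "real ^ 'n"
    have inj: "inj (\<lambda>k::'n. axis k (1::real))" by (auto simp: inj_def axis_eq_axis)
    have Bas: "(Basis :: (real ^ 'n) set) = range (\<lambda>k. axis k 1)" by (auto simp: Basis_vec_def)
    have "(\<Prod>v\<in>(Basis :: (real ^ 'n) set). ennreal (f (axis_index v) (x \<bullet> v)) * indicator (?I (axis_index v)) (x \<bullet> v)) =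
        (\<Prod>k\<in>UNIV. ennreal (f k (x $ k)) * indicator (?I k) (x $ k))"
      by (simp add: Bas prod.reindex[OF inj] axis_index_axis cart_eq_inner_axis)
    also have "\<dots> = (\<Prod>k\<in>UNIV. ennreal (f k (x $ k))) * (\<Prod>k\<in>UNIV. indicator (?I k) (x $ k))"
      by (rule prod.distrib)
    also have "(\<Prod>k\<in>UNIV. ennreal (f k (x $ k))) = ennreal (joint_density f x)"
      by (simp add: joint_density_def prod_ennreal f_nonneg)
    also have "(\<Prod>k\<in>UNIV. indicator (?I k) (x $ k)) = (indicator B x :: ennreal)"
      unfolding B by (auto simp: indicator_def box)
    finally show "(\<Prod>v\<in>(Basis :: (real ^ 'n) set). ennreal (f (axis_index v) (x \<bullet> v)) * indicator (?I (axis_index v)) (x \<bullet> v)) =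
        ennreal (joint_density f x) * indicator B x" .
  qed
  also have "\<dots> = emeasure (density lborel (\<lambda>x. ennreal (joint_density f x))) B"
    unfolding B by (subst emeasure_density) auto
  finally show "emeasure (distr M borel X) B = emeasure (density lborel (\<lambda>x. ennreal (joint_density f x))) B" .
qed

abbreviation "box_borel \<equiv> restrict_space borel (cbox a b)"

text \<open>
  Transfers all statements about the weighted space to expectations.
\<close>

lemma weighted_measure_eq_distr: "weighted_measure a b f = distr M box_borel X"
proof (rule measure_eqI)
  show sets: "sets (weighted_measure a b f) = sets (distr M box_borel X)"
    by (simp add: weighted_measure_def sets_restrict_space)
  fix A assume "A \<in> sets (weighted_measure a b f)"
  then have A: "A \<in> sets borel" "A \<subseteq> cbox a b" and A': "A \<in> sets box_borel"
    unfolding sets by (auto simp: sets_restrict_space_iff)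
  have "emeasure (weighted_measure a b f) A =
      (\<integral>\<^sup>+x. ennreal (joint_density f x) * indicator A x \<partial>restrict_space lborel (cbox a b))"
    unfolding weighted_measure_def using A
    by (subst emeasure_density) (auto intro!: measurable_restrict_space1 simp: sets_restrict_space_iff)
  also have "\<dots> = (\<integral>\<^sup>+x. ennreal (joint_density f x) * indicator A x * indicator (cbox a b) x \<partial>lborel)"
    by (subst nn_integral_restrict_space) auto
  also have "\<dots> = (\<integral>\<^sup>+x. ennreal (joint_density f x) * indicator A x \<partial>lborel)"
    using A(2) by (intro nn_integral_cong) (auto simp: indicator_def)
  also have "\<dots> = emeasure (density lborel (\<lambda>x. ennreal (joint_density f x))) A"
    using A by (subst emeasure_density) auto
  also have "\<dots> = emeasure (distr M borel X) A"
    by (simp only: distr_X_eq_density)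
  also have "\<dots> = emeasure (distr M box_borel X) A"
    using A A' X_meas by (simp add: emeasure_distr)
  finally show "emeasure (weighted_measure a b f) A = emeasure (distr M box_borel X) A" .
qed

lemma weighted_integral:
  assumes h: "h \<in> borel_measurable box_borel"
  shows "integrable (weighted_measure a b f) h \<longleftrightarrow> integrable M (\<lambda>\<omega>. h (X \<omega>))"
    and "integral\<^sup>L (weighted_measure a b f) h = (LINT \<omega>|M. h (X \<omega>))"
    and "set_integrable lborel (cbox a b) (\<lambda>x. h x * joint_density f x) \<longleftrightarrow> integrable M (\<lambda>\<omega>. h (X \<omega>))"
    and "(LINT x:cbox a b|lborel. h x * joint_density f x) = (LINT \<omega>|M. h (X \<omega>))"
proof -
  show 1: "integrable (weighted_measure a b f) h \<longleftrightarrow> integrable M (\<lambda>\<omega>. h (X \<omega>))"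
    unfolding weighted_measure_eq_distr by (rule integrable_distr_eq[OF X_meas h])
  show 2: "integral\<^sup>L (weighted_measure a b f) h = (LINT \<omega>|M. h (X \<omega>))"
    unfolding weighted_measure_eq_distr by (rule integral_distr[OF X_meas h])
  let ?L = "restrict_space lborel (cbox a b)"
  have h': "h \<in> borel_measurable ?L"
    using h by (simp cong: measurable_cong_sets add: sets_restrict_space)
  have J: "joint_density f \<in> borel_measurable ?L"
    by (intro measurable_restrict_space1) simp
  have nn: "AE x in ?L. 0 \<le> joint_density f x" by (simp add: joint_density_nonneg)
  show "set_integrable lborel (cbox a b) (\<lambda>x. h x * joint_density f x) \<longleftrightarrow> integrable M (\<lambda>\<omega>. h (X \<omega>))"
    unfolding 1[symmetric] weighted_measure_def integrable_density[OF h' J nn] set_integrable_def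
    by (subst integrable_restrict_space) (simp_all add: mult.commute)
  show "(LINT x:cbox a b|lborel. h x * joint_density f x) = (LINT \<omega>|M. h (X \<omega>))"
    unfolding 2[symmetric] weighted_measure_def integral_density[OF h' J nn] set_lebesgue_integral_def
    by (subst integral_restrict_space) (simp_all add: mult.commute)
qed

lemma weighted_square_integrable:
  assumes h: "h \<in> borel_measurable box_borel" and int: "integrable M (\<lambda>\<omega>. (h (X \<omega>))\<^sup>2)"
  shows "square_integrable M (\<lambda>\<omega>. h (X \<omega>))" "square_integrable (weighted_measure a b f) h"
proof -
  show "square_integrable M (\<lambda>\<omega>. h (X \<omega>))"
    unfolding square_integrable_def using int measurable_compose[OF X_meas h] by simp
  have "h \<in> borel_measurable (weighted_measure a b f)"
    unfolding weighted_measure_eq_distr using h by simp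
  moreover have "(\<lambda>x. (h x)\<^sup>2) \<in> borel_measurable box_borel" using h by simp
  ultimately show "square_integrable (weighted_measure a b f) h"
    unfolding square_integrable_def using weighted_integral(1) int by blast
qed

lemma weighted_L2_norm:
  assumes "h \<in> borel_measurable box_borel"
  shows "L2_norm (weighted_measure a b f) h = sqrt (LINT \<omega>|M. (h (X \<omega>))\<^sup>2)"
  unfolding L2_norm_def using assms by (subst weighted_integral(2)) simp_all

lemma orth_mbspline_box_borel:
  assumes "i \<in> multi_indices n"
  shows "orth_mbspline M X b n p \<xi> i \<in> borel_measurable box_borel"
proof -
  have "\<Psi> i \<in> borel_measurable box_borel"
    using \<Psi>_borel[OF assms] by (rule measurable_restrict_space1)
  then show ?thesis
    by (rule measurable_cong[THEN iffD1, rotated]) (simp add: space_restrict_space \<Psi>_eq)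
qed

lemma orth_mbspline_X: "\<omega> \<in> space M \<Longrightarrow> orth_mbspline M X b n p \<xi> i (X \<omega>) = \<Psi> i (X \<omega>)"
  using \<Psi>_eq[OF X_in_box] by simp

lemma orth_mbspline_orthonormal:
  assumes "i \<in> multi_indices n" "j \<in> multi_indices n"
  shows "integrable M (\<lambda>\<omega>. orth_mbspline M X b n p \<xi> i (X \<omega>) * orth_mbspline M X b n p \<xi> j (X \<omega>))"
    and "(LINT \<omega>|M. orth_mbspline M X b n p \<xi> i (X \<omega>) * orth_mbspline M X b n p \<xi> j (X \<omega>)) =
      (if i = j then 1 else 0)"
proof -
  let ?O = "orth_mbspline M X b n p \<xi>"
  have "integrable M (\<lambda>\<omega>. ?O i (X \<omega>) * ?O j (X \<omega>)) \<longleftrightarrow> integrable M (\<lambda>\<omega>. \<Psi> i (X \<omega>) * \<Psi> j (X \<omega>))"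
    "(LINT \<omega>|M. ?O i (X \<omega>) * ?O j (X \<omega>)) = (LINT \<omega>|M. \<Psi> i (X \<omega>) * \<Psi> j (X \<omega>))"
    by (intro Bochner_Integration.integrable_cong Bochner_Integration.integral_cong;
        simp add: orth_mbspline_X)+
  then show "integrable M (\<lambda>\<omega>. ?O i (X \<omega>) * ?O j (X \<omega>))"
    "(LINT \<omega>|M. ?O i (X \<omega>) * ?O j (X \<omega>)) = (if i = j then 1 else 0)"
    using \<Psi>_orthonormal[OF assms] by simp_all
qed

context
  fixes y :: "real ^ 'n \<Rightarrow> real"
  assumes y: "y \<in> borel_measurable box_borel" and y2: "square_integrable M (\<lambda>\<omega>. y (X \<omega>))"
begin

text \<open>
  By \<open>2 \<bar>u v\<bar> \<le> u\<^sup>2 + v\<^sup>2\<close>.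
\<close>

lemma square_integrable_coefficient:
  assumes i: "i \<in> multi_indices n"
  shows "integrable M (\<lambda>\<omega>. y (X \<omega>) * \<Psi> i (X \<omega>))"
proof (rule Bochner_Integration.integrable_bound)
  have [measurable]: "(\<lambda>\<omega>. y (X \<omega>)) \<in> borel_measurable M" "\<Psi> i \<in> borel_measurable borel"
    using measurable_compose[OF X_meas y] \<Psi>_borel[OF i] by auto
  show "(\<lambda>\<omega>. y (X \<omega>) * \<Psi> i (X \<omega>)) \<in> borel_measurable M" by measurable
  show "integrable M (\<lambda>\<omega>. (y (X \<omega>))\<^sup>2 + \<Psi> i (X \<omega>) * \<Psi> i (X \<omega>))"
    using y2 \<Psi>_orthonormal(1)[OF i i] by (simp add: square_integrable_def)
  have "norm (u * v) \<le> norm (u\<^sup>2 + v * v)" for u v :: real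
  proof -
    have "2 * (\<bar>u\<bar> * \<bar>v\<bar>) \<le> u * u + v * v"
      using sum_squares_bound[of "\<bar>u\<bar>" "\<bar>v\<bar>"] by (simp add: power2_eq_square)
    moreover have "0 \<le> \<bar>u\<bar> * \<bar>v\<bar>" by simp
    ultimately have "\<bar>u\<bar> * \<bar>v\<bar> \<le> u * u + v * v" by linarith
    then show ?thesis by (simp add: abs_mult power2_eq_square)
  qed
  then show "AE \<omega> in M. norm (y (X \<omega>) * \<Psi> i (X \<omega>)) \<le> norm ((y (X \<omega>))\<^sup>2 + \<Psi> i (X \<omega>) * \<Psi> i (X \<omega>))"
    by blast
qed

lemma orth_mbspline_coefficient:
  "integrable M (\<lambda>\<omega>. y (X \<omega>) * orth_mbspline M X b n p \<xi> i (X \<omega>)) \<longleftrightarrow>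
     integrable M (\<lambda>\<omega>. y (X \<omega>) * \<Psi> i (X \<omega>))"
  "sce_coeff M X b n p \<xi> y i = (LINT \<omega>|M. y (X \<omega>) * \<Psi> i (X \<omega>))"
  unfolding sce_coeff_def
  by (intro Bochner_Integration.integrable_cong Bochner_Integration.integral_cong;
      simp add: orth_mbspline_X)+

lemma sce_coeff_integral:
  assumes i: "i \<in> multi_indices n"
  shows "integrable M (\<lambda>\<omega>. y (X \<omega>) * orth_mbspline M X b n p \<xi> i (X \<omega>)) \<and>
    set_integrable lborel (cbox a b) (\<lambda>x. y x * orth_mbspline M X b n p \<xi> i x * joint_density f x) \<and>
    sce_coeff M X b n p \<xi> y i =
      (LINT x:cbox a b|lborel. y x * orth_mbspline M X b n p \<xi> i x * joint_density f x)"
proof -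
  let ?O = "orth_mbspline M X b n p \<xi>"
  have int: "integrable M (\<lambda>\<omega>. y (X \<omega>) * ?O i (X \<omega>))"
    unfolding orth_mbspline_coefficient by (rule square_integrable_coefficient[OF i])
  moreover have m: "(\<lambda>x. y x * ?O i x) \<in> borel_measurable box_borel"
    using y orth_mbspline_box_borel[OF i] by simp
  ultimately show ?thesis
    unfolding sce_coeff_def weighted_integral(3)[OF m] weighted_integral(4)[OF m] by simp
qed

text \<open>
  On the box every member of the tensor-product space, and the expansion itself, has the form \<open>W d\<close>, so
  the error formula compares them all. The infimum is attained at \<open>W C\<close>, the extension by zero of the
  expansion: the expansion itself need not lie in the space, since it is unconstrained outside the box.
\<close>

lemma sce_best_approximation:
  shows "g \<in> insert (sce M X b n p \<xi> y) (tensor_spline_space a b n p \<xi>) \<Longrightarrow>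
      square_integrable M (\<lambda>\<omega>. y (X \<omega>) - g (X \<omega>)) \<and>
      square_integrable (weighted_measure a b f) (\<lambda>x. y x - g x)" (is "_ \<Longrightarrow> ?errors")
    and "(LINT \<omega>|M. (y (X \<omega>) - sce M X b n p \<xi> y (X \<omega>))\<^sup>2) =
       (INF g \<in> tensor_spline_space a b n p \<xi>. LINT \<omega>|M. (y (X \<omega>) - g (X \<omega>))\<^sup>2)" (is ?inf)
    and "L2_norm (weighted_measure a b f) (\<lambda>x. y x - sce M X b n p \<xi> y x) =
       (INF g \<in> tensor_spline_space a b n p \<xi>. L2_norm (weighted_measure a b f) (\<lambda>x. y x - g x))"
      (is ?inf_norm)
proof -
  let ?V = "tensor_spline_space a b n p \<xi>"
    and ?s = "sce M X b n p \<xi> y" and ?C = "sce_coeff M X b n p \<xi> y"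
  define W where "W d x = (\<Sum>i\<in>multi_indices n. d i * \<Psi> i x)" for d x
  have V: "?V = range W" unfolding tensor_spline_space_eq W_def ..
  have W_borel: "W d \<in> borel_measurable box_borel" for d
    unfolding W_def using \<Psi>_borel
    by (intro measurable_restrict_space1 borel_measurable_sum borel_measurable_times) auto
  have s_eq: "?s x = W ?C x" if "x \<in> cbox a b" for x
    unfolding sce_def W_def using \<Psi>_eq[OF that] by simp
  have s_borel: "?s \<in> borel_measurable box_borel"
    using W_borel[of ?C] by (rule measurable_cong[THEN iffD1, rotated]) (simp add: space_restrict_space s_eq)
  note expansion = orthonormal_expansion_error[OF finite_multi_indices \<Psi>_orthonormal
      _ square_integrable_coefficient, folded W_def orth_mbspline_coefficient(2)]
  have yy: "integrable M (\<lambda>\<omega>. (y (X \<omega>))\<^sup>2)" using y2 by (simp add: square_integrable_def)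
  have err_int: "integrable M (\<lambda>\<omega>. (y (X \<omega>) - W d (X \<omega>))\<^sup>2)"
    and err: "(LINT \<omega>|M. (y (X \<omega>) - W d (X \<omega>))\<^sup>2) = (LINT \<omega>|M. (y (X \<omega>))\<^sup>2)
      - (\<Sum>i\<in>multi_indices n. (?C i)\<^sup>2) + (\<Sum>i\<in>multi_indices n. (d i - ?C i)\<^sup>2)" for d
    by (rule expansion[OF _ _ _ _ yy]; assumption)+
  have s_err_int: "integrable M (\<lambda>\<omega>. (y (X \<omega>) - ?s (X \<omega>))\<^sup>2)"
    using err_int[of ?C]
    by (rule Bochner_Integration.integrable_cong[THEN iffD1, rotated 2]) (simp_all add: s_eq X_in_box)
  have s_err: "(LINT \<omega>|M. (y (X \<omega>) - ?s (X \<omega>))\<^sup>2) = (LINT \<omega>|M. (y (X \<omega>) - W ?C (X \<omega>))\<^sup>2)"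
    by (intro Bochner_Integration.integral_cong) (simp_all add: s_eq X_in_box)
  have g_borel: "(\<lambda>x. y x - g x) \<in> borel_measurable box_borel" if "g \<in> insert ?s ?V" for g
    using that y s_borel W_borel unfolding V by auto
  have g_int: "integrable M (\<lambda>\<omega>. (y (X \<omega>) - g (X \<omega>))\<^sup>2)" if "g \<in> insert ?s ?V" for g
    using that s_err_int err_int unfolding V by auto
  {
    assume g: "g \<in> insert ?s ?V"
    show ?errors
      using weighted_square_integrable[OF g_borel[OF g] g_int[OF g]] by (rule conjI)
  }
  have sE: "W ?C \<in> ?V" unfolding V by (rule rangeI)
  have min: "(LINT \<omega>|M. (y (X \<omega>) - ?s (X \<omega>))\<^sup>2) \<le> (LINT \<omega>|M. (y (X \<omega>) - g (X \<omega>))\<^sup>2)"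
    if "g \<in> ?V" for g
    using that unfolding V s_err by (auto simp: err intro!: sum_nonneg)
  show ?inf
    by (rule cInf_eq_minimum[symmetric]) (auto simp: s_err intro!: image_eqI[OF _ sE] min[unfolded s_err])
  have norm: "L2_norm (weighted_measure a b f) (\<lambda>x. y x - g x) = sqrt (LINT \<omega>|M. (y (X \<omega>) - g (X \<omega>))\<^sup>2)"
    if "g \<in> insert ?s ?V" for g
    by (rule weighted_L2_norm[OF g_borel[OF that]])
  show ?inf_norm
  proof (rule cInf_eq_minimum[symmetric])
    show "L2_norm (weighted_measure a b f) (\<lambda>x. y x - ?s x) \<in>
        (\<lambda>g. L2_norm (weighted_measure a b f) (\<lambda>x. y x - g x)) ` ?V"
      using sE norm[of ?s] norm[of "W ?C"] by (intro image_eqI[OF _ sE]) (simp add: s_err)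
    fix t assume "t \<in> (\<lambda>g. L2_norm (weighted_measure a b f) (\<lambda>x. y x - g x)) ` ?V"
    then obtain g where g: "g \<in> ?V" "t = L2_norm (weighted_measure a b f) (\<lambda>x. y x - g x)" by blast
    show "L2_norm (weighted_measure a b f) (\<lambda>x. y x - ?s x) \<le> t"
      using min[OF g(1)] norm[of ?s] norm[of g] g by simp
  qed
qed

end

end

section \<open>The spline chaos expansion\<close>

theorem theorem6p1:
  fixes M :: "'w measure"
    and X :: "'w \<Rightarrow> real ^ ('n::finite)"
    and a b :: "real ^ 'n"
    and f :: "'n \<Rightarrow> real \<Rightarrow> real"
    and n p :: "'n \<Rightarrow> nat"
    and \<xi> :: "'n \<Rightarrow> nat \<Rightarrow> real"
    and y :: "real ^ 'n \<Rightarrow> real"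
  assumes "prob_space M"
    and "\<And>k. a $ k < b $ k"
    and "X \<in> measurable M (restrict_space borel (cbox a b))"
    and "prob_space.indep_vars M (\<lambda>_. borel) (\<lambda>k \<omega>. X \<omega> $ k) UNIV"
    and "\<And>k. distributed M lborel (\<lambda>\<omega>. X \<omega> $ k) (\<lambda>x. ennreal (f k x))"
    and "\<And>k x. 0 \<le> f k x"
    and "\<And>k. continuous_on {a $ k..b $ k} (f k)"
    and "\<And>k. closure {x. 0 < f k x} = {a $ k..b $ k}"
    and "\<And>k. open_knot_seq (a $ k) (b $ k) (n k) (p k) (\<xi> k)"
    and "y \<in> borel_measurable (restrict_space borel (cbox a b))"
    and "square_integrable M (\<lambda>\<omega>. y (X \<omega>))"
  shows
    \<comment> \<open>the expansion functions are orthonormal\<close>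
    "(\<forall>i \<in> multi_indices n. \<forall>j \<in> multi_indices n.
        integrable M (\<lambda>\<omega>. orth_mbspline M X b n p \<xi> i (X \<omega>) * orth_mbspline M X b n p \<xi> j (X \<omega>)) \<and>
        (LINT \<omega>|M. orth_mbspline M X b n p \<xi> i (X \<omega>) * orth_mbspline M X b n p \<xi> j (X \<omega>)) =
          (if i = j then 1 else 0)) \<and>
     \<comment> \<open>the coefficients are well defined and given by either expression\<close>
     (\<forall>i \<in> multi_indices n.
        integrable M (\<lambda>\<omega>. y (X \<omega>) * orth_mbspline M X b n p \<xi> i (X \<omega>)) \<and>
        set_integrable lborel (cbox a b)
          (\<lambda>x. y x * orth_mbspline M X b n p \<xi> i x * joint_density f x) \<and>
        sce_coeff M X b n p \<xi> y i =
          (LINT x:cbox a b|lborel. y x * orth_mbspline M X b n p \<xi> i x * joint_density f x)) \<and>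
     \<comment> \<open>all approximation errors below are genuine (finite) \<open>L\<^sup>2\<close> errors\<close>
     (\<forall>g \<in> insert (sce M X b n p \<xi> y) (tensor_spline_space a b n p \<xi>).
        square_integrable M (\<lambda>\<omega>. y (X \<omega>) - g (X \<omega>)) \<and>
        square_integrable (weighted_measure a b f) (\<lambda>x. y x - g x)) \<and>
     \<comment> \<open>best approximation\<close>
     (LINT \<omega>|M. (y (X \<omega>) - sce M X b n p \<xi> y (X \<omega>))\<^sup>2) =
       (INF g \<in> tensor_spline_space a b n p \<xi>. LINT \<omega>|M. (y (X \<omega>) - g (X \<omega>))\<^sup>2) \<and>
     L2_norm (weighted_measure a b f) (\<lambda>x. y x - sce M X b n p \<xi> y x) =
       (INF g \<in> tensor_spline_space a b n p \<xi>. L2_norm (weighted_measure a b f) (\<lambda>x. y x - g x))"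
proof -
  interpret random_spline_vector M X a b f n p \<xi>
    using assms(1-9) unfolding random_spline_vector_def random_spline_vector_axioms_def by blast
  note y = assms(10,11)
  show ?thesis
    using orth_mbspline_orthonormal sce_coeff_integral[OF y] sce_best_approximation[OF y] by blast
qed

end
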